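(* Let $(A,\circ)$ be a Novikov algebra and let $R=\mathbf{k}[\partial]A$ be the Lie conformal algebra corresponding to $(A,\circ)$. Let $\Delta:A\to A\otimes A$ be a linear map. Then $(R,[\cdot_\lambda\cdot],\delta)$ is a Lie conformal bialgebra with the $\mathbf{k}[\partial]$-module homomorphism $\delta:R\to R\otimes R$ given by $$\delta(a)=(\partial\otimes\mathrm{id})\Delta(a)-\tau(\partial\otimes\mathrm{id})\Delta(a),\qquad a\in A,$$ if and only if $(A,\circ,\Delta)$ is a Novikov bialgebra.
   Context: Conventions: $\mathbf{k}$ is a field of characteristic $0$; vector spaces over $\mathbf{k}$ are finite-dimensional and $\mathbf{k}[\partial]$-modules are finitely generated; $\otimes=\otimes_{\mathbf{k}}$; $\tau(a\otimes b)=b\otimes a$. $L_\circ(a)b=a\circ b$, $R_\circ(a)b=b\circ a$, $a\star b=a\circ b+b\circ a$, $L_\star(a)b=a\star b$. A Novikov algebra $(A,\circ)$ satisfies $(a\circ b)\circ c-a\circ(b\circ c)=(b\circ a)\circ c-b\circ(a\circ c)$ and $(a\circ b)\circ c=(a\circ c)\circ b$. A Novikov coalgebra $(A,\Delta)$: $\Delta:A\to A\otimes A$ linear with $(\mathrm{id}\otimes\Delta)\Delta(a)-(\tau\otimes\mathrm{id})(\mathrm{id}\otimes\Delta)\Delta(a)=(\Delta\otimes\mathrm{id})\Delta(a)-(\tau\otimes\mathrm{id})(\Delta\otimes\mathrm{id})\Delta(a)$ and $(\tau\otimes\mathrm{id})(\mathrm{id}\otimes\Delta)\tau\Delta(a)=(\Delta\otimes\mathrm{id})\Delta(a)$.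 A Novikov bialgebra $(A,\circ,\Delta)$: $(A,\circ)$ is a Novikov algebra, $(A,\Delta)$ is a Novikov coalgebra, and for all $a,b\in A$: $\Delta(a\circ b)=(R_\circ(b)\otimes\mathrm{id})\Delta(a)+(\mathrm{id}\otimes L_\star(a))(\Delta(b)+\tau\Delta(b))$; $(L_\star(a)\otimes\mathrm{id})\Delta(b)-(\mathrm{id}\otimes L_\star(a))\tau\Delta(b)=(L_\star(b)\otimes\mathrm{id})\Delta(a)-(\mathrm{id}\otimes L_\star(b))\tau\Delta(a)$; $(\mathrm{id}\otimes R_\circ(a)-R_\circ(a)\otimes\mathrm{id})(\Delta(b)+\tau\Delta(b))=(\mathrm{id}\otimes R_\circ(b)-R_\circ(b)\otimes\mathrm{id})(\Delta(a)+\tau\Delta(a))$. A Lie conformal algebra is a $\mathbf{k}[\partial]$-module $R$ with a $\mathbf{k}$-bilinear map $[\cdot_\lambda\cdot]:R\times R\to R[\lambda]$ such that $[\partial a_\lambda b]=-\lambda[a_\lambda b]$, $[a_\lambda\partial b]=(\lambda+\partial)[a_\lambda b]$, $[a_\lambda b]=-[b_{-\lambda-\partial}a]$, $[a_\lambda[b_\mu c]]=[[a_\lambda b]_{\lambda+\mu}c]+[b_\mu[a_\lambda c]]$. The Lie conformal algebra corresponding to a Novikov algebra $(A,\circ)$ is the free module $R=\mathbf{k}[\partial]A=\mathbf{k}[\partial]\otimes_{\mathbf{k}}A$ with $[a_\lambda b]=\partial(b\circ a)+\lambda(a\star b)$ for $a,b\in A$, extended by the first two identities. $R\otimes R$ is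 a $\mathbf{k}[\partial]$-module via $\partial\otimes\mathrm{id}+\mathrm{id}\otimes\partial$. A Lie conformal coalgebra $(R,\delta)$: $\delta:R\to R\otimes R$ a $\mathbf{k}[\partial]$-module homomorphism with $\delta=-\tau\delta$ and $(\mathrm{id}\otimes\delta)\delta-(\tau\otimes\mathrm{id})(\mathrm{id}\otimes\delta)\delta=(\delta\otimes\mathrm{id})\delta$. A Lie conformal bialgebra $(R,[\cdot_\lambda\cdot],\delta)$: a Lie conformal algebra and Lie conformal coalgebra with $a_\lambda\delta(b)-b_{-\lambda-\partial}\delta(a)=\delta([a_\lambda b])$ for all $a,b\in R$, where $a_\lambda(\sum b_{(1)}\otimes b_{(2)})=\sum([a_\lambda b_{(1)}]\otimes b_{(2)}+b_{(1)}\otimes[a_\lambda b_{(2)}])$, and in $b_{-\lambda-\partial}\delta(a)$ the symbol $\partial$ denotes $\partial\otimes\mathrm{id}+\mathrm{id}\otimes\partial$. *)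

theory Defs
  imports "HOL-Computational_Algebra.Polynomial" "HOL-Library.Function_Algebras"
begin

section \<open>Multilinear maps and tensor products over a field\<close>

definition bilinear_map ::
  "('k::field \<Rightarrow> 'a::ab_group_add \<Rightarrow> 'a) \<Rightarrow> ('k \<Rightarrow> 'b::ab_group_add \<Rightarrow> 'b) \<Rightarrow>
   ('k \<Rightarrow> 'c::ab_group_add \<Rightarrow> 'c) \<Rightarrow> ('a \<Rightarrow> 'b \<Rightarrow> 'c) \<Rightarrow> bool" where
  "bilinear_map s1 s2 s3 f \<longleftrightarrow>
     (\<forall>x. Vector_Spaces.linear s2 s3 (f x)) \<and> (\<forall>y. Vector_Spaces.linear s1 s3 (\<lambda>x. f x y))"

definition trilinear_map ::
  "('k::field \<Rightarrow> 'a::ab_group_add \<Rightarrow> 'a) \<Rightarrow> ('k \<Rightarrow> 'c::ab_group_add \<Rightarrow> 'c) \<Rightarrow>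
   ('a \<Rightarrow> 'a \<Rightarrow> 'a \<Rightarrow> 'c) \<Rightarrow> bool" where
  "trilinear_map s s' f \<longleftrightarrow>
     (\<forall>y z. Vector_Spaces.linear s s' (\<lambda>x. f x y z)) \<and>
     (\<forall>x z. Vector_Spaces.linear s s' (\<lambda>y. f x y z)) \<and>
     (\<forall>x y. Vector_Spaces.linear s s' (\<lambda>z. f x y z))"

text \<open>
  Scale functions carry the vector space structures, so a tensor product cannot be a type
  constructor.  We realise \<open>A \<otimes> B\<close> as the span of the evaluation functionals
  \<open>\<beta> \<mapsto> \<beta>(a, b)\<close> on bilinear forms \<open>\<beta> : A \<times> B \<rightarrow> k\<close> (extended by \<open>0\<close> to functions that are not
  bilinear).  Over a field this is a tensor product: see \<open>tensor_universal\<close> below.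
  Likewise \<open>A \<otimes> A \<otimes> A\<close> is realised by evaluations of trilinear forms; this identifies
  \<open>(A \<otimes> A) \<otimes> A\<close> with \<open>A \<otimes> (A \<otimes> A)\<close>.
\<close>

type_synonym ('a, 'b, 'k) tens2 = "('a \<Rightarrow> 'b \<Rightarrow> 'k) \<Rightarrow> 'k"
type_synonym ('a, 'k) tens3 = "('a \<Rightarrow> 'a \<Rightarrow> 'a \<Rightarrow> 'k) \<Rightarrow> 'k"

definition fscale :: "'k::field \<Rightarrow> ('f \<Rightarrow> 'k) \<Rightarrow> 'f \<Rightarrow> 'k" where
  "fscale c t = (\<lambda>\<beta>. c * t \<beta>)"

definition tensor ::
  "('k::field \<Rightarrow> 'a::ab_group_add \<Rightarrow> 'a) \<Rightarrow> ('k \<Rightarrow> 'b::ab_group_add \<Rightarrow> 'b) \<Rightarrow>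
   'a \<Rightarrow> 'b \<Rightarrow> ('a, 'b, 'k) tens2" where
  "tensor s1 s2 a b = (\<lambda>\<beta>. if bilinear_map s1 s2 (*) \<beta> then \<beta> a b else 0)"

definition tensor_space ::
  "('k::field \<Rightarrow> 'a::ab_group_add \<Rightarrow> 'a) \<Rightarrow> ('k \<Rightarrow> 'b::ab_group_add \<Rightarrow> 'b) \<Rightarrow>
   ('a, 'b, 'k) tens2 set" where
  "tensor_space s1 s2 = module.span fscale {tensor s1 s2 a b | a b. True}"

definition tensor3 ::
  "('k::field \<Rightarrow> 'a::ab_group_add \<Rightarrow> 'a) \<Rightarrow> 'a \<Rightarrow> 'a \<Rightarrow> 'a \<Rightarrow> ('a, 'k) tens3" where
  "tensor3 s a b c = (\<lambda>\<beta>. if trilinear_map s (*) \<beta> then \<beta> a b c else 0)"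

text \<open>\<open>f \<otimes> g\<close>; the scale functions are those of the target spaces.\<close>

definition tensor_map ::
  "('k::field \<Rightarrow> 'c::ab_group_add \<Rightarrow> 'c) \<Rightarrow> ('k \<Rightarrow> 'd::ab_group_add \<Rightarrow> 'd) \<Rightarrow>
   ('a \<Rightarrow> 'c) \<Rightarrow> ('b \<Rightarrow> 'd) \<Rightarrow> ('a, 'b, 'k) tens2 \<Rightarrow> ('c, 'd, 'k) tens2" where
  "tensor_map s1 s2 f g t =
     (\<lambda>\<beta>. if bilinear_map s1 s2 (*) \<beta> then t (\<lambda>x y. \<beta> (f x) (g y)) else 0)"

text \<open>The flip \<open>\<tau>\<close> and \<open>\<tau> \<otimes> id\<close>.\<close>

definition flip2 ::
  "('k::field \<Rightarrow> 'a::ab_group_add \<Rightarrow> 'a) \<Rightarrow> ('a, 'a, 'k) tens2 \<Rightarrow> ('a, 'a, 'k) tens2" where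
  "flip2 s t = (\<lambda>\<beta>. if bilinear_map s s (*) \<beta> then t (\<lambda>x y. \<beta> y x) else 0)"

definition flip_id ::
  "('k::field \<Rightarrow> 'a::ab_group_add \<Rightarrow> 'a) \<Rightarrow> ('a, 'k) tens3 \<Rightarrow> ('a, 'k) tens3" where
  "flip_id s t = (\<lambda>\<beta>. if trilinear_map s (*) \<beta> then t (\<lambda>x y z. \<beta> y x z) else 0)"

text \<open>\<open>id \<otimes> D\<close> and \<open>D \<otimes> id\<close> as maps \<open>A \<otimes> A \<rightarrow> A \<otimes> A \<otimes> A\<close>, for \<open>D : A \<rightarrow> A \<otimes> A\<close>.\<close>

definition id_tensor ::
  "('k::field \<Rightarrow> 'a::ab_group_add \<Rightarrow> 'a) \<Rightarrow> ('a \<Rightarrow> ('a, 'a, 'k) tens2) \<Rightarrow>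
   ('a, 'a, 'k) tens2 \<Rightarrow> ('a, 'k) tens3" where
  "id_tensor s D t =
     (\<lambda>\<beta>. if trilinear_map s (*) \<beta> then t (\<lambda>x y. D y (\<lambda>u v. \<beta> x u v)) else 0)"

definition tensor_id ::
  "('k::field \<Rightarrow> 'a::ab_group_add \<Rightarrow> 'a) \<Rightarrow> ('a \<Rightarrow> ('a, 'a, 'k) tens2) \<Rightarrow>
   ('a, 'a, 'k) tens2 \<Rightarrow> ('a, 'k) tens3" where
  "tensor_id s D t =
     (\<lambda>\<beta>. if trilinear_map s (*) \<beta> then t (\<lambda>x y. D x (\<lambda>u v. \<beta> u v y)) else 0)"


subsection \<open>Adequacy of the model of the tensor product\<close>

lemma vector_space_fscale: "vector_space (fscale :: 'k::field \<Rightarrow> ('f \<Rightarrow> 'k) \<Rightarrow> 'f \<Rightarrow> 'k)"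
  by unfold_locales (auto simp: fscale_def fun_eq_iff algebra_simps)

lemma vector_space_mult: "vector_space ((*) :: 'k::field \<Rightarrow> 'k \<Rightarrow> 'k)"
  by unfold_locales (auto simp: algebra_simps)

lemma bilinear_compose:
  assumes "bilinear_map s1 s2 s3 F" "Vector_Spaces.linear s3 s4 h"
  shows "bilinear_map s1 s2 s4 (\<lambda>a b. h (F a b))"
  using assms Vector_Spaces.linear_compose[of s1 s3 _ s4 h] Vector_Spaces.linear_compose[of s2 s3 _ s4 h]
  unfolding bilinear_map_def by (auto simp: o_def)

lemma trilinear_compose:
  assumes "trilinear_map s s3 F" "Vector_Spaces.linear s3 s4 h"
  shows "trilinear_map s s4 (\<lambda>a b c. h (F a b c))"
  using assms Vector_Spaces.linear_compose[of _ s3 _ s4 h] unfolding trilinear_map_def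
  by (auto simp: o_def)

lemma functional_separates:
  fixes s :: "'k::field \<Rightarrow> 'c::ab_group_add \<Rightarrow> 'c"
  assumes "vector_space s" "v \<noteq> 0"
  shows "\<exists>\<phi>. Vector_Spaces.linear s (*) \<phi> \<and> \<phi> v \<noteq> 0"
proof -
  interpret vs: vector_space s by fact
  interpret k: vector_space "(*) :: 'k \<Rightarrow> 'k \<Rightarrow> 'k" by (rule vector_space_mult)
  interpret p: vector_space_pair s "(*) :: 'k \<Rightarrow> 'k \<Rightarrow> 'k" ..
  have ind: "vs.independent {v}" using assms(2) by simp
  show ?thesis
    using p.linear_construct[OF ind, of "\<lambda>_. 1"] p.construct_basis[OF ind, of v "\<lambda>_. 1"]
    by (intro exI[of _ "p.construct {v} (\<lambda>_. 1)"]) auto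
qed

lemma factor_through_functionals:
  fixes s :: "'k::field \<Rightarrow> 'c::ab_group_add \<Rightarrow> 'c" and e :: "'i \<Rightarrow> 'f \<Rightarrow> 'k" and F :: "'i \<Rightarrow> 'c"
  assumes vs: "vector_space s"
    and eval: "\<And>\<phi>. Vector_Spaces.linear s (*) \<phi> \<Longrightarrow> \<exists>\<beta>. \<forall>i. e i \<beta> = \<phi> (F i)"
  shows "\<exists>h. Vector_Spaces.linear fscale s h \<and> (\<forall>i. h (e i) = F i)"
proof -
  interpret c: vector_space s by fact
  interpret f: vector_space "fscale :: 'k \<Rightarrow> ('f \<Rightarrow> 'k) \<Rightarrow> 'f \<Rightarrow> 'k" by (rule vector_space_fscale)
  interpret p: vector_space_pair "fscale :: 'k \<Rightarrow> ('f \<Rightarrow> 'k) \<Rightarrow> 'f \<Rightarrow> 'k" s ..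
  obtain B where B: "B \<subseteq> range e" "f.independent B" "range e \<subseteq> f.span B"
    using f.maximal_independent_subset[of "range e"] by metis
  define g where "g b = F (SOME i. e i = b)" for b
  define h where "h = p.construct B g"
  have lin: "Vector_Spaces.linear fscale s h"
    unfolding h_def by (rule p.linear_construct[OF B(2)])
  interpret h: Vector_Spaces.linear fscale s h by fact
  have "h (e i) = F i" for i
  proof (rule ccontr)
    assume "h (e i) \<noteq> F i"
    hence "h (e i) - F i \<noteq> 0" by simp
    then obtain \<phi> where phi: "Vector_Spaces.linear s (*) \<phi>" "\<phi> (h (e i) - F i) \<noteq> 0"
      using functional_separates[OF vs] by blast
    interpret phi: Vector_Spaces.linear s "(*) :: 'k \<Rightarrow> 'k \<Rightarrow> 'k" \<phi> by (rule phi(1))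
    obtain \<beta> where beta: "\<And>j. e j \<beta> = \<phi> (F j)" using eval[OF phi(1)] by blast
    have "t \<beta> = \<phi> (h t)" if "t \<in> f.span B" for t
      using that
    proof (induction rule: f.span_induct_alt)
      case base
      have "\<phi> (h 0) = 0" by (simp only: h.zero phi.zero)
      thus ?case by (simp add: zero_fun_def)
    next
      case (step c x y)
      obtain j where j: "e j = x" using step(1) B(1) by blast
      hence "e (SOME i. e i = x) = x" by (rule someI)
      hence "x \<beta> = \<phi> (g x)" using beta unfolding g_def by metis
      also have "g x = h x" unfolding h_def using p.construct_basis[OF B(2) step(1)] by simp
      finally have "x \<beta> = \<phi> (h x)" .
      moreover have "\<phi> (h (fscale c x + y)) = c * \<phi> (h x) + \<phi> (h y)"
        by (simp only: h.add h.scale phi.add phi.scale)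
      ultimately show ?case using step(2) by (simp add: fscale_def plus_fun_def)
    qed
    moreover have "e i \<in> f.span B" using B(3) by blast
    ultimately have "\<phi> (h (e i)) = \<phi> (F i)" using beta[of i] by metis
    thus False using phi(2) by (simp add: phi.diff)
  qed
  thus ?thesis using lin by blast
qed

lemma bilinear_tensor:
  assumes "vector_space s1" "vector_space s2"
  shows "bilinear_map s1 s2 fscale (tensor s1 s2)"
proof -
  have lin: "Vector_Spaces.linear s2 (*) (\<beta> x)" "Vector_Spaces.linear s1 (*) (\<lambda>x. \<beta> x y)"
    if "bilinear_map s1 s2 (*) \<beta>" for \<beta> x y
    using that by (auto simp: bilinear_map_def)
  have rules:
    "\<beta> x (y + z) = \<beta> x y + \<beta> x z" "\<beta> x (s2 c y) = c * \<beta> x y"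
    "\<beta> (x + w) y = \<beta> x y + \<beta> w y" "\<beta> (s1 c x) y = c * \<beta> x y"
    if "bilinear_map s1 s2 (*) \<beta>" for \<beta> x y z w c
    using lin(1)[OF that, of x] lin(2)[OF that, of y] unfolding Vector_Spaces.linear_iff by auto
  show ?thesis
    using assms vector_space_fscale
    unfolding bilinear_map_def Vector_Spaces.linear_iff
    by (auto simp: tensor_def fscale_def fun_eq_iff rules)
qed

theorem tensor_universal:
  assumes "vector_space s1" "vector_space s2" "vector_space s3"
    and F: "bilinear_map s1 s2 s3 F"
  shows "\<exists>h. Vector_Spaces.linear fscale s3 h \<and> (\<forall>a b. h (tensor s1 s2 a b) = F a b)"
    and "\<lbrakk>Vector_Spaces.linear fscale s3 h; Vector_Spaces.linear fscale s3 h';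
          \<forall>a b. h (tensor s1 s2 a b) = F a b; \<forall>a b. h' (tensor s1 s2 a b) = F a b;
          t \<in> tensor_space s1 s2\<rbrakk> \<Longrightarrow> h t = h' t"
proof -
  have "\<exists>\<beta>. \<forall>i. case_prod (tensor s1 s2) i \<beta> = \<phi> (case_prod F i)"
    if "Vector_Spaces.linear s3 (*) \<phi>" for \<phi>
    using bilinear_compose[OF F that]
    by (intro exI[of _ "\<lambda>a b. \<phi> (F a b)"]) (auto simp: tensor_def)
  from factor_through_functionals[OF assms(3) this]
  show "\<exists>h. Vector_Spaces.linear fscale s3 h \<and> (\<forall>a b. h (tensor s1 s2 a b) = F a b)" by auto
next
  assume lin: "Vector_Spaces.linear fscale s3 h" "Vector_Spaces.linear fscale s3 h'"
    and eq: "\<forall>a b. h (tensor s1 s2 a b) = F a b" "\<forall>a b. h' (tensor s1 s2 a b) = F a b"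
    and t: "t \<in> tensor_space s1 s2"
  interpret p: vector_space_pair "fscale :: 'a \<Rightarrow> (('b \<Rightarrow> 'c \<Rightarrow> 'a) \<Rightarrow> 'a) \<Rightarrow> _" s3
    using vector_space_fscale assms(3) by (rule vector_space_pair.intro)
  show "h t = h' t"
    by (rule p.linear_eq_on[OF lin t[unfolded tensor_space_def]]) (use eq in auto)
qed

lemma tensor3_universal:
  assumes "vector_space s3" and F: "trilinear_map s s3 F"
  shows "\<exists>h. Vector_Spaces.linear fscale s3 h \<and> (\<forall>a b c. h (tensor3 s a b c) = F a b c)"
proof -
  let ?c = "\<lambda>f (a, b, c). f a b c"
  have "\<exists>\<beta>. \<forall>i. ?c (tensor3 s) i \<beta> = \<phi> (?c F i)"
    if "Vector_Spaces.linear s3 (*) \<phi>" for \<phi>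
    using trilinear_compose[OF F that]
    by (intro exI[of _ "\<lambda>a b c. \<phi> (F a b c)"]) (auto simp: tensor3_def)
  from factor_through_functionals[OF assms(1) this] show ?thesis by auto
qed

lemma tensor_map_tensor:
  assumes "Vector_Spaces.linear s1 s1' f" "Vector_Spaces.linear s2 s2' g"
  shows "tensor_map s1' s2' f g (tensor s1 s2 a b) = tensor s1' s2' (f a) (g b)"
proof -
  have "bilinear_map s1 s2 (*) (\<lambda>x y. \<beta> (f x) (g y))" if "bilinear_map s1' s2' (*) \<beta>" for \<beta>
    using that Vector_Spaces.linear_compose[OF assms(1), of "(*)"] Vector_Spaces.linear_compose[OF assms(2), of "(*)"]
    unfolding bilinear_map_def by (auto simp: o_def)
  thus ?thesis by (auto simp: tensor_map_def tensor_def fun_eq_iff)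
qed

lemma flip2_tensor: "flip2 s (tensor s s a b) = tensor s s b a"
  by (auto simp: flip2_def tensor_def fun_eq_iff bilinear_map_def)

lemma flip_id_tensor3: "flip_id s (tensor3 s a b c) = tensor3 s b a c"
  by (auto simp: flip_id_def tensor3_def fun_eq_iff trilinear_map_def)

lemma tensor_space_linear:
  fixes s1 :: "'a::field \<Rightarrow> 'b::ab_group_add \<Rightarrow> 'b" and s2 :: "'a \<Rightarrow> 'c::ab_group_add \<Rightarrow> 'c"
  assumes "t \<in> tensor_space s1 s2" "bilinear_map s1 s2 (*) \<beta>" "bilinear_map s1 s2 (*) \<gamma>"
    and "bilinear_map s1 s2 (*) (\<lambda>x y. \<beta> x y + \<gamma> x y)" "bilinear_map s1 s2 (*) (\<lambda>x y. c * \<beta> x y)"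
  shows "t (\<lambda>x y. \<beta> x y + \<gamma> x y) = t \<beta> + t \<gamma>" "t (\<lambda>x y. c * \<beta> x y) = c * t \<beta>"
proof -
  interpret f: vector_space "fscale :: 'a \<Rightarrow> (('b \<Rightarrow> 'c \<Rightarrow> 'a) \<Rightarrow> 'a) \<Rightarrow> _" by (rule vector_space_fscale)
  have "t (\<lambda>x y. \<beta> x y + \<gamma> x y) = t \<beta> + t \<gamma> \<and> t (\<lambda>x y. c * \<beta> x y) = c * t \<beta>"
    using assms(1) unfolding tensor_space_def
  proof (induction rule: f.span_induct_alt)
    case base
    show ?case by simp
  next
    case (step d x y)
    then show ?case using assms(2-5) by (auto simp: tensor_def fscale_def algebra_simps)
  qed
  thus "t (\<lambda>x y. \<beta> x y + \<gamma> x y) = t \<beta> + t \<gamma>" "t (\<lambda>x y. c * \<beta> x y) = c * t \<beta>" by auto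
qed

lemma sum_apply: "(\<Sum>i\<in>I. f i) x = (\<Sum>i\<in>I. f i x)" for f :: "'i \<Rightarrow> 'f \<Rightarrow> 'k::comm_monoid_add"
  by (induction I rule: infinite_finite_induct) auto

lemma trilinear_bilinear:
  assumes "trilinear_map s (*) \<beta>"
  shows "bilinear_map s s (*) (\<beta> x)" "bilinear_map s s (*) (\<lambda>u v. \<beta> u v x)"
    and "bilinear_map s s (*) (\<lambda>u v. \<beta> x u v + \<beta> y u v)"
    and "bilinear_map s s (*) (\<lambda>u v. \<beta> u v x + \<beta> u v y)"
    and "bilinear_map s s (*) (\<lambda>u v. c * \<beta> x u v)"
    and "bilinear_map s s (*) (\<lambda>u v. c * \<beta> u v x)"
  using assms unfolding trilinear_map_def bilinear_map_def Vector_Spaces.linear_iff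
  by (auto simp: algebra_simps)

lemma id_tensor_tensor:
  assumes D: "Vector_Spaces.linear s fscale D" "\<And>a. D a \<in> tensor_space s s"
    and b: "D b = (\<Sum>i\<in>I. tensor s s (u i) (v i))"
  shows "id_tensor s D (tensor s s a b) = (\<Sum>i\<in>I. tensor3 s a (u i) (v i))"
    and "tensor_id s D (tensor s s b a) = (\<Sum>i\<in>I. tensor3 s (u i) (v i) a)"
proof -
  have add: "D (x + y) = D x + D y" and scale: "D (s c x) = fscale c (D x)" for x y c
    using D(1) unfolding Vector_Spaces.linear_iff by auto
  have vs: "vector_space s" using D(1) unfolding Vector_Spaces.linear_iff by auto
  have 1: "bilinear_map s s (*) (\<lambda>x y. D y (\<lambda>u v. \<beta> x u v))"
    and 2: "bilinear_map s s (*) (\<lambda>x y. D x (\<lambda>u v. \<beta> u v y))" if T: "trilinear_map s (*) \<beta>" for \<beta>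
  proof -
    have lin: "\<beta> (x + y) u v = \<beta> x u v + \<beta> y u v" "\<beta> (s c x) u v = c * \<beta> x u v"
      "\<beta> u v (x + y) = \<beta> u v x + \<beta> u v y" "\<beta> u v (s c x) = c * \<beta> u v x" for x y c u v
      using T unfolding trilinear_map_def Vector_Spaces.linear_iff by auto
    have lin': "\<beta> (x + y) = (\<lambda>u v. \<beta> x u v + \<beta> y u v)" "\<beta> (s c x) = (\<lambda>u v. c * \<beta> x u v)" for x y c
      by (intro ext lin)+
    note bil = trilinear_bilinear[OF T]
    show "bilinear_map s s (*) (\<lambda>x y. D y (\<lambda>u v. \<beta> x u v))"
      unfolding bilinear_map_def Vector_Spaces.linear_iff
      using tensor_space_linear[OF D(2) bil(1) bil(1) bil(3) bil(5)] vs vector_space_mult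
      by (auto simp: add scale fscale_def lin')
    show "bilinear_map s s (*) (\<lambda>x y. D x (\<lambda>u v. \<beta> u v y))"
      unfolding bilinear_map_def Vector_Spaces.linear_iff
      using tensor_space_linear[OF D(2) bil(2) bil(2) bil(4) bil(6)] vs vector_space_mult
      by (auto simp: add scale fscale_def lin(3,4))
  qed
  show "id_tensor s D (tensor s s a b) = (\<Sum>i\<in>I. tensor3 s a (u i) (v i))"
  proof
    fix \<beta>
    show "id_tensor s D (tensor s s a b) \<beta> = (\<Sum>i\<in>I. tensor3 s a (u i) (v i)) \<beta>"
      using 1[of \<beta>] trilinear_bilinear(1)[of s \<beta> a]
      by (auto simp: id_tensor_def tensor3_def tensor_def sum_apply b)
  qed
  show "tensor_id s D (tensor s s b a) = (\<Sum>i\<in>I. tensor3 s (u i) (v i) a)"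
  proof
    fix \<beta>
    show "tensor_id s D (tensor s s b a) \<beta> = (\<Sum>i\<in>I. tensor3 s (u i) (v i) a) \<beta>"
      using 2[of \<beta>] trilinear_bilinear(2)[of s \<beta> a]
      by (auto simp: tensor_id_def tensor3_def tensor_def sum_apply b)
  qed
qed


section \<open>Novikov algebras, coalgebras and bialgebras\<close>

definition novikov_algebra ::
  "('k::field \<Rightarrow> 'a::ab_group_add \<Rightarrow> 'a) \<Rightarrow> ('a \<Rightarrow> 'a \<Rightarrow> 'a) \<Rightarrow> bool" where
  "novikov_algebra s m \<longleftrightarrow>
     (\<exists>Basis. finite_dimensional_vector_space s Basis) \<and>
     bilinear_map s s s m \<and>
     (\<forall>a b c. m (m a b) c - m a (m b c) = m (m b a) c - m b (m a c)) \<and>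
     (\<forall>a b c. m (m a b) c = m (m a c) b)"

definition star :: "('a::ab_group_add \<Rightarrow> 'a \<Rightarrow> 'a) \<Rightarrow> 'a \<Rightarrow> 'a \<Rightarrow> 'a" where
  "star m a b = m a b + m b a"

definition linear_to_tensor ::
  "('k::field \<Rightarrow> 'a::ab_group_add \<Rightarrow> 'a) \<Rightarrow> ('a \<Rightarrow> ('a, 'a, 'k) tens2) \<Rightarrow> bool" where
  "linear_to_tensor s D \<longleftrightarrow>
     Vector_Spaces.linear s fscale D \<and> (\<forall>a. D a \<in> tensor_space s s)"

definition novikov_coalgebra ::
  "('k::field \<Rightarrow> 'a::ab_group_add \<Rightarrow> 'a) \<Rightarrow> ('a \<Rightarrow> ('a, 'a, 'k) tens2) \<Rightarrow> bool" where
  "novikov_coalgebra s D \<longleftrightarrow>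
     (\<exists>Basis. finite_dimensional_vector_space s Basis) \<and>
     linear_to_tensor s D \<and>
     (\<forall>a. id_tensor s D (D a) - flip_id s (id_tensor s D (D a)) =
          tensor_id s D (D a) - flip_id s (tensor_id s D (D a))) \<and>
     (\<forall>a. flip_id s (id_tensor s D (flip2 s (D a))) = tensor_id s D (D a))"

text \<open>In the three compatibility conditions, \<open>\<lambda>x. m x b\<close> is \<open>R(b)\<close>.\<close>

definition novikov_bialgebra ::
  "('k::field \<Rightarrow> 'a::ab_group_add \<Rightarrow> 'a) \<Rightarrow> ('a \<Rightarrow> 'a \<Rightarrow> 'a) \<Rightarrow> ('a \<Rightarrow> ('a, 'a, 'k) tens2) \<Rightarrow> bool" where
  "novikov_bialgebra s m D \<longleftrightarrow>
     novikov_algebra s m \<and> novikov_coalgebra s D \<and>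
     (\<forall>a b. D (m a b) =
        tensor_map s s (\<lambda>x. m x b) id (D a) +
        tensor_map s s id (star m a) (D b + flip2 s (D b))) \<and>
     (\<forall>a b.
        tensor_map s s (star m a) id (D b) - tensor_map s s id (star m a) (flip2 s (D b)) =
        tensor_map s s (star m b) id (D a) - tensor_map s s id (star m b) (flip2 s (D a))) \<and>
     (\<forall>a b.
        tensor_map s s id (\<lambda>x. m x a) (D b + flip2 s (D b)) -
          tensor_map s s (\<lambda>x. m x a) id (D b + flip2 s (D b)) =
        tensor_map s s id (\<lambda>x. m x b) (D a + flip2 s (D a)) -
          tensor_map s s (\<lambda>x. m x b) id (D a + flip2 s (D a)))"


section \<open>Lie conformal algebras, coalgebras and bialgebras\<close>

text \<open>
  A \<open>k[\<partial>]\<close>-module is a module over the polynomial ring \<open>'k poly\<close> in the sense of locale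
  \<open>module\<close>; \<open>\<partial>\<close> acts as \<open>X = [:0, 1:]\<close>, and \<open>k\<close> acts through the constant polynomials.
\<close>

definition kscale :: "('k::field poly \<Rightarrow> 'r \<Rightarrow> 'r) \<Rightarrow> 'k \<Rightarrow> 'r \<Rightarrow> 'r" where
  "kscale sm c = sm [:c:]"

definition der :: "('k::field poly \<Rightarrow> 'r \<Rightarrow> 'r) \<Rightarrow> 'r \<Rightarrow> 'r" where
  "der sm = sm [:0, 1:]"

definition fg_module :: "('k::field poly \<Rightarrow> 'r::ab_group_add \<Rightarrow> 'r) \<Rightarrow> bool" where
  "fg_module sm \<longleftrightarrow> module sm \<and> (\<exists>S. finite S \<and> module.span sm S = UNIV)"

text \<open>
  Substitution in a polynomial \<open>p = \<Sum> \<lambda>\<^sup>n p\<^sub>n\<close>: replace \<open>\<lambda>\<close> by the operator \<open>X\<close> acting on the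
  images of the coefficients, giving \<open>\<Sum> X\<^sup>n (f p\<^sub>n)\<close>.
\<close>

definition subst :: "('w \<Rightarrow> 'w::ab_group_add) \<Rightarrow> ('v::zero \<Rightarrow> 'w) \<Rightarrow> 'v poly \<Rightarrow> 'w" where
  "subst X f p = (\<Sum>n\<le>degree p. (X ^^ n) (f (coeff p n)))"

text \<open>The substitution \<open>\<lambda> \<mapsto> -\<lambda> - \<partial>\<close> in \<open>V[\<lambda>]\<close>, where \<open>d\<close> is the action of \<open>\<partial>\<close> on \<open>V\<close>.\<close>

definition subst_minus :: "('v::ab_group_add \<Rightarrow> 'v) \<Rightarrow> 'v poly \<Rightarrow> 'v poly" where
  "subst_minus d = subst (\<lambda>w. - pCons 0 w - map_poly d w) (\<lambda>v. [:v:])"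

text \<open>
  A \<open>\<lambda>\<close>-bracket has values in \<open>R[\<lambda>] = 'r poly\<close>.  The Jacobi identity lives in
  \<open>R[\<lambda>][\<mu>] = 'r poly poly\<close>: the outer variable is \<open>\<mu>\<close>, the inner one \<open>\<lambda>\<close>, so
  multiplication by \<open>\<mu>\<close> is \<open>pCons 0\<close> and multiplication by \<open>\<lambda>\<close> is \<open>map_poly (pCons 0)\<close>.
\<close>

definition lie_conformal_algebra ::
  "('k::field poly \<Rightarrow> 'r::ab_group_add \<Rightarrow> 'r) \<Rightarrow> ('r \<Rightarrow> 'r \<Rightarrow> 'r poly) \<Rightarrow> bool" where
  "lie_conformal_algebra sm br \<longleftrightarrow>
     fg_module sm \<and>
     bilinear_map (kscale sm) (kscale sm) (\<lambda>c. map_poly (kscale sm c)) br \<and>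
     (\<forall>a b. br (der sm a) b = - pCons 0 (br a b)) \<and>
     (\<forall>a b. br a (der sm b) = pCons 0 (br a b) + map_poly (der sm) (br a b)) \<and>
     (\<forall>a b. br a b = - subst_minus (der sm) (br b a)) \<and>
     (\<forall>a b c.
        (let mul_mu = pCons 0; mul_lambda = map_poly (pCons 0) in
         subst mul_mu (\<lambda>d. [:br a d:]) (br b c) =
         subst mul_lambda (\<lambda>d. subst (\<lambda>w. mul_lambda w + mul_mu w) (\<lambda>e. [:[:e:]:]) (br d c)) (br a b) +
         subst mul_lambda (\<lambda>d. subst mul_mu (\<lambda>e. [:[:e:]:]) (br b d)) (br a c)))"

text \<open>The operator \<open>\<partial> \<otimes> id + id \<otimes> \<partial>\<close> and the resulting \<open>k[\<partial>]\<close>-module structure on \<open>R \<otimes> R\<close>.\<close>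

definition tensor_der ::
  "('k::field poly \<Rightarrow> 'r::ab_group_add \<Rightarrow> 'r) \<Rightarrow> ('r, 'r, 'k) tens2 \<Rightarrow> ('r, 'r, 'k) tens2" where
  "tensor_der sm t =
     tensor_map (kscale sm) (kscale sm) (der sm) id t + tensor_map (kscale sm) (kscale sm) id (der sm) t"

definition tensor_smult ::
  "('k::field poly \<Rightarrow> 'r::ab_group_add \<Rightarrow> 'r) \<Rightarrow> 'k poly \<Rightarrow> ('r, 'r, 'k) tens2 \<Rightarrow> ('r, 'r, 'k) tens2" where
  "tensor_smult sm q t = (\<Sum>n\<le>degree q. fscale (coeff q n) ((tensor_der sm ^^ n) t))"

definition lie_conformal_coalgebra ::
  "('k::field poly \<Rightarrow> 'r::ab_group_add \<Rightarrow> 'r) \<Rightarrow> ('r \<Rightarrow> ('r, 'r, 'k) tens2) \<Rightarrow> bool" where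
  "lie_conformal_coalgebra sm \<delta> \<longleftrightarrow>
     fg_module sm \<and>
     module_hom sm (tensor_smult sm) \<delta> \<and>
     (\<forall>a. \<delta> a \<in> tensor_space (kscale sm) (kscale sm)) \<and>
     (\<forall>a. \<delta> a = - flip2 (kscale sm) (\<delta> a)) \<and>
     (\<forall>a. id_tensor (kscale sm) \<delta> (\<delta> a) - flip_id (kscale sm) (id_tensor (kscale sm) \<delta> (\<delta> a)) =
          tensor_id (kscale sm) \<delta> (\<delta> a))"

text \<open>
  The action \<open>a\<^sub>\<lambda>\<close> of \<open>a\<close> on \<open>R \<otimes> R\<close>, with values in \<open>(R \<otimes> R)[\<lambda>]\<close>: the coefficient at \<open>\<lambda>\<^sup>n\<close> is
  \<open>a\<^sub>n \<otimes> id + id \<otimes> a\<^sub>n\<close>, where \<open>a\<^sub>n b\<close> is the coefficient of \<open>[a\<^sub>\<lambda> b]\<close> at \<open>\<lambda>\<^sup>n\<close>.  For bilinear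
  brackets and \<open>t \<in> R \<otimes> R\<close> almost all coefficients vanish; see \<open>coeff_tensor_act\<close>.
\<close>

definition tensor_act ::
  "('k::field poly \<Rightarrow> 'r::ab_group_add \<Rightarrow> 'r) \<Rightarrow> ('r \<Rightarrow> 'r \<Rightarrow> 'r poly) \<Rightarrow>
   'r \<Rightarrow> ('r, 'r, 'k) tens2 \<Rightarrow> ('r, 'r, 'k) tens2 poly" where
  "tensor_act sm br a t = Abs_poly (\<lambda>n.
     tensor_map (kscale sm) (kscale sm) (\<lambda>x. coeff (br a x) n) id t +
     tensor_map (kscale sm) (kscale sm) id (\<lambda>x. coeff (br a x) n) t)"

lemma coeff_tensor_act:
  assumes br: "bilinear_map (kscale sm) (kscale sm) (\<lambda>c. map_poly (kscale sm c)) br"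
    and t: "t \<in> tensor_space (kscale sm) (kscale sm)"
  shows "coeff (tensor_act sm br a t) n =
     tensor_map (kscale sm) (kscale sm) (\<lambda>x. coeff (br a x) n) id t +
     tensor_map (kscale sm) (kscale sm) id (\<lambda>x. coeff (br a x) n) t"
proof -
  let ?s = "kscale sm"
  interpret f: vector_space "fscale :: 'a \<Rightarrow> (('b \<Rightarrow> 'b \<Rightarrow> 'a) \<Rightarrow> 'a) \<Rightarrow> _" by (rule vector_space_fscale)
  have vs: "vector_space ?s" using br unfolding bilinear_map_def Vector_Spaces.linear_iff by blast
  interpret r: vector_space ?s by fact
  have lin: "Vector_Spaces.linear ?s ?s (\<lambda>x. coeff (br a x) n)" for n
    using br vs unfolding bilinear_map_def Vector_Spaces.linear_iff by (auto simp: coeff_map_poly)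
  have lin_id: "Vector_Spaces.linear ?s ?s id" using vs unfolding Vector_Spaces.linear_iff by simp
  have zero: "tensor ?s ?s 0 y = 0" "tensor ?s ?s y 0 = 0" for y
  proof -
    have "\<beta> 0 y = 0 \<and> \<beta> y 0 = 0" if "bilinear_map ?s ?s (*) \<beta>" for \<beta>
    proof -
      have "\<beta> (0 + 0) y = \<beta> 0 y + \<beta> 0 y" "\<beta> y (0 + 0) = \<beta> y 0 + \<beta> y 0"
        using that unfolding bilinear_map_def Vector_Spaces.linear_iff by blast+
      thus ?thesis unfolding add_0_left by (simp only: add_cancel_right_right)
    qed
    thus "tensor ?s ?s 0 y = 0" "tensor ?s ?s y 0 = 0" by (auto simp: tensor_def fun_eq_iff)
  qed
  have ev: "\<forall>\<^sub>\<infinity>n. tensor_map ?s ?s (\<lambda>x. coeff (br a x) n) id t +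
     tensor_map ?s ?s id (\<lambda>x. coeff (br a x) n) t = 0"
    using t unfolding tensor_space_def
  proof (induction rule: f.span_induct_alt)
    case base
    show ?case by (simp add: tensor_map_def fun_eq_iff)
  next
    case (step c x y)
    then obtain u v where x: "x = tensor ?s ?s u v" by blast
    have "\<forall>\<^sub>\<infinity>n. coeff (br a u) n = 0 \<and> coeff (br a v) n = 0"
      using MOST_coeff_eq_0 MOST_conjI by blast
    moreover note step(2)
    ultimately show ?case
    proof eventually_elim
      case (elim n)
      have "tensor_map ?s ?s (\<lambda>x. coeff (br a x) n) id x = 0"
        "tensor_map ?s ?s id (\<lambda>x. coeff (br a x) n) x = 0"
        unfolding x tensor_map_tensor[OF lin lin_id] tensor_map_tensor[OF lin_id lin]
        using elim(1) by (simp_all add: zero)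
      with elim(2) show ?case
        by (auto simp: tensor_map_def fscale_def fun_eq_iff algebra_simps split: if_splits)
    qed
  qed
  show ?thesis unfolding tensor_act_def using ev by (simp add: Abs_poly_inverse)
qed

definition lie_conformal_bialgebra ::
  "('k::field poly \<Rightarrow> 'r::ab_group_add \<Rightarrow> 'r) \<Rightarrow> ('r \<Rightarrow> 'r \<Rightarrow> 'r poly) \<Rightarrow>
   ('r \<Rightarrow> ('r, 'r, 'k) tens2) \<Rightarrow> bool" where
  "lie_conformal_bialgebra sm br \<delta> \<longleftrightarrow>
     lie_conformal_algebra sm br \<and> lie_conformal_coalgebra sm \<delta> \<and>
     (\<forall>a b. tensor_act sm br a (\<delta> b) - subst_minus (tensor_der sm) (tensor_act sm br b (\<delta> a)) =
            map_poly \<delta> (br a b))"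


section \<open>The Lie conformal algebra of a Novikov algebra\<close>

text \<open>\<open>k[\<partial>]A = k[\<partial>] \<otimes> A\<close> is \<open>'a poly\<close>, polynomials in \<open>\<partial>\<close> with coefficients in \<open>A\<close>.\<close>

definition poly_smult ::
  "('k::field \<Rightarrow> 'a::ab_group_add \<Rightarrow> 'a) \<Rightarrow> 'k poly \<Rightarrow> 'a poly \<Rightarrow> 'a poly" where
  "poly_smult s q p =
     (\<Sum>i\<le>degree q. \<Sum>j\<le>degree p. monom (s (coeff q i) (coeff p j)) (i + j))"

text \<open>
  On \<open>A\<close> the bracket is \<open>[a\<^sub>\<lambda> b] = \<partial>(b \<circ> a) + \<lambda>(a \<star> b)\<close> (\<open>\<lambda>\<close> is the outer variable); sesquilinearity
  extends it by \<open>[\<partial>\<^sup>i a \<^sub>\<lambda> \<partial>\<^sup>j b] = (-\<lambda>)\<^sup>i (\<lambda> + \<partial>)\<^sup>j [a\<^sub>\<lambda> b]\<close>.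
\<close>

definition novikov_bracket ::
  "('a::ab_group_add \<Rightarrow> 'a \<Rightarrow> 'a) \<Rightarrow> 'a poly \<Rightarrow> 'a poly \<Rightarrow> 'a poly poly" where
  "novikov_bracket m p q =
     subst (\<lambda>w. - pCons 0 w)
       (\<lambda>a. subst (\<lambda>w. pCons 0 w + map_poly (pCons 0) w)
              (\<lambda>b. [:[:0, m b a:], [:star m a b:]:]) q) p"

text \<open>
  \<open>tensor_map \<dots> (\<lambda>a. [:a:]) (\<lambda>a. [:a:])\<close> is the map \<open>A \<otimes> A \<rightarrow> R \<otimes> R\<close> induced by \<open>A \<subseteq> R\<close>.
\<close>

definition novikov_cobracket_gen ::
  "('k::field \<Rightarrow> 'a::ab_group_add \<Rightarrow> 'a) \<Rightarrow> ('a \<Rightarrow> ('a, 'a, 'k) tens2) \<Rightarrow>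
   'a \<Rightarrow> ('a poly, 'a poly, 'k) tens2" where
  "novikov_cobracket_gen s D a =
     (let sm = poly_smult s; ks = kscale sm;
          w = tensor_map ks ks (der sm) id (tensor_map ks ks (\<lambda>a. [:a:]) (\<lambda>a. [:a:]) (D a))
      in w - flip2 ks w)"

definition novikov_cobracket ::
  "('k::field \<Rightarrow> 'a::ab_group_add \<Rightarrow> 'a) \<Rightarrow> ('a \<Rightarrow> ('a, 'a, 'k) tens2) \<Rightarrow>
   'a poly \<Rightarrow> ('a poly, 'a poly, 'k) tens2" where
  "novikov_cobracket s D = subst (tensor_der (poly_smult s)) (novikov_cobracket_gen s D)"

lemma novikov_bracket_const:
  "novikov_bracket m [:a:] [:b:] = [:[:0, m b a:], [:star m a b:]:]"
  by (simp add: novikov_bracket_def subst_def)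

lemma novikov_cobracket_const: "novikov_cobracket s D [:a:] = novikov_cobracket_gen s D a"
  by (simp add: novikov_cobracket_def subst_def)

end

theory Submission
  imports Defs
begin

text \<open>
  Write \<open>x = \<partial> \<otimes> id\<close> and \<open>y = id \<otimes> \<partial>\<close>.  Since \<open>R = k[\<partial>]A\<close> is free, \<open>R \<otimes> R = (A \<otimes> A)[x, y]\<close>, and on \<open>A\<close>
  the cobracket is \<open>\<delta>(a) = x \<Delta>(a) - y \<tau>\<Delta>(a)\<close>.  The co-Jacobi identity and the cocycle condition on \<open>A\<close> thus
  become identities between polynomials with coefficients in tensor powers of \<open>A\<close>, and the theorem
  comes from comparing coefficients.

  All conditions on \<open>R\<close> are compatible with \<open>\<partial>\<close>: replacing an argument by its image under \<open>\<partial>\<close> applies one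
  fixed linear operator to the defect of the identity.  So each of them holds on \<open>R\<close> as soon as it holds on
  \<open>A\<close>; this is done in \<open>skew_symmetric_if_constants\<close>, \<open>jacobi_if_constants\<close>, \<open>cojac_if_constants\<close> and
  \<open>cocycle_if_constants\<close>.

  On \<open>A\<close>, the bracket satisfies the Lie conformal axioms by left symmetry and right commutativity of \<open>\<circ>\<close>.
  In the co-Jacobi identity, a polynomial of degree \<open>2\<close> in \<open>x, y, z\<close>, the squares \<open>x\<^sup>2, y\<^sup>2, z\<^sup>2\<close> each give the
  second Novikov coalgebra axiom, and the mixed terms \<open>xy, xz, yz\<close> the first one
  (\<open>coalgebra_equivalence\<close>).  The cocycle condition on \<open>A\<close> has degree \<open>2\<close> in \<open>\<lambda>, x, y\<close>: the coefficient
  of \<open>x\<^sup>2\<close> is the formula for \<open>\<Delta>(b \<circ> a)\<close>, that of \<open>\<lambda>\<^sup>2\<close> is the compatibility condition on \<open>L\<^sub>\<star>\<close>, and that of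
  \<open>xy\<close> is, modulo the first, the condition on \<open>R\<^sub>\<circ>\<close>.  The remaining coefficients follow from these
  (\<open>compat_if_cocycle\<close>, \<open>cocycle_if_compat\<close>).

  Tensors are functionals on multilinear forms, so a coefficient is read off by evaluation at a form
  \<open>(p, q) \<mapsto> \<gamma>(p\<^sub>i, q\<^sub>j)\<close>, where \<open>p\<^sub>i\<close> is the coefficient of \<open>p\<close> at \<open>\<partial>\<^sup>i\<close>.  Conversely, a form \<open>\<beta>\<close> on \<open>R\<close> gives
  the forms \<open>(u, v) \<mapsto> \<beta>(\<partial>\<^sup>i u, \<partial>\<^sup>j v)\<close> on \<open>A\<close>.
\<close>

section \<open>Substitution of an operator into a polynomial\<close>

lemma funpow_zero:
  fixes X :: "'w \<Rightarrow> 'w::ab_group_add"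
  assumes "Modules.additive X"
  shows "(X ^^ n) 0 = 0"
  by (induction n) (simp_all add: additive.zero[OF assms])

lemma subst_cutoff:
  assumes "Modules.additive X" "f 0 = 0" "degree p \<le> N"
  shows "subst X f p = (\<Sum>n\<le>N. (X ^^ n) (f (coeff p n)))"
  unfolding subst_def
  by (rule sum.mono_neutral_left)
     (use assms in \<open>auto simp: coeff_eq_0 funpow_zero\<close>)

lemma subst_zero: "subst X f 0 = f 0"
  by (simp add: subst_def)

lemma subst_pCons:
  assumes X: "Modules.additive X" and f: "f 0 = 0"
  shows "subst X f (pCons a p) = f a + X (subst X f p)"
proof -
  have "subst X f (pCons a p) = (\<Sum>n\<le>Suc (degree p). (X ^^ n) (f (coeff (pCons a p) n)))"
    by (rule subst_cutoff[where f = f, OF X f]) (simp add: degree_pCons_le)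
  also have "\<dots> = f a + (\<Sum>n\<le>degree p. X ((X ^^ n) (f (coeff p n))))"
    by (subst sum.atMost_Suc_shift) simp
  also have "\<dots> = f a + X (subst X f p)"
    by (simp add: subst_def additive.sum[OF X])
  finally show ?thesis .
qed

lemma additive_subst:
  assumes X: "Modules.additive X" and f: "Modules.additive f"
  shows "Modules.additive (subst X f)"
proof
  fix p q
  show "subst X f (p + q) = subst X f p + subst X f q"
  proof (induction p arbitrary: q)
    case 0
    show ?case by (simp add: subst_zero additive.zero[OF f])
  next
    case (pCons a p)
    show ?case
    proof (cases q)
      case (pCons b r)
      show ?thesis
        by (simp add: pCons subst_pCons[where f = f, OF X additive.zero[OF f]] pCons.IH additive.add[OF X]
            additive.add[OF f])
    qed
  qed
qed

lemma subst_map_poly: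
  assumes X: "Modules.additive X" and f: "f 0 = 0" and d: "d 0 = 0"
  shows "subst X f (map_poly d p) = subst X (\<lambda>v. f (d v)) p"
  by (induction p)
     (simp_all add: subst_zero f d map_poly_pCons subst_pCons[OF X] assms)

text \<open>
  An operator that commutes with the substituted one can be pulled out; with \<open>X\<close> multiplication by a
  variable, this carries \<open>\<partial>\<close> and the other variables through the nested substitutions of the Jacobi identity.
\<close>

lemma subst_commute:
  assumes X: "Modules.additive X" and Y: "Modules.additive Y" and f: "f 0 = 0"
    and comm: "\<And>w. Y (X w) = X (Y w)"
  shows "subst X (\<lambda>v. Y (f v)) p = Y (subst X f p)"
  by (induction p)
     (simp_all add: subst_zero f additive.zero[OF Y] subst_pCons[OF X] additive.add[OF Y] comm)

lemma additive_comp: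
  "Modules.additive f \<Longrightarrow> Modules.additive g \<Longrightarrow> Modules.additive (\<lambda>x. f (g x))"
  by (simp add: additive_def)

lemma additive_plus:
  fixes f g :: "'a::ab_group_add \<Rightarrow> 'b::ab_group_add"
  shows "Modules.additive f \<Longrightarrow> Modules.additive g \<Longrightarrow> Modules.additive (\<lambda>x. f x + g x)"
  by (simp add: additive_def algebra_simps)

lemma additive_minus:
  fixes f g :: "'a::ab_group_add \<Rightarrow> 'b::ab_group_add"
  shows "Modules.additive f \<Longrightarrow> Modules.additive g \<Longrightarrow> Modules.additive (\<lambda>x. f x - g x)"
  by (simp add: additive_def algebra_simps)

lemma additive_uminus:
  fixes f :: "'a::ab_group_add \<Rightarrow> 'b::ab_group_add"
  shows "Modules.additive f \<Longrightarrow> Modules.additive (\<lambda>x. - f x)"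
  by (simp add: additive_def algebra_simps)

lemma additive_funpow:
  fixes X :: "'w \<Rightarrow> 'w::ab_group_add"
  shows "Modules.additive X \<Longrightarrow> Modules.additive (X ^^ n)"
  by (induction n) (simp_all add: additive_def)

lemma additive_subst_fun:
  assumes X: "Modules.additive X" and f: "\<And>v. Modules.additive (\<lambda>a. f a v)"
  shows "Modules.additive (\<lambda>a. subst X (f a) p)"
  using additive.add[OF additive_funpow[OF X]] additive.add[OF f]
  by (simp add: additive_def subst_def sum.distrib)

lemma additive_id: "Modules.additive (\<lambda>x. x)"
  by (simp add: additive_def)

lemma additive_pCons: "Modules.additive (pCons 0)"
  by (simp add: additive_def)

lemma additive_const_poly: "Modules.additive (\<lambda>v. [:v:])"
  by (simp add: additive_def)

lemma additive_map_poly: "Modules.additive d \<Longrightarrow> Modules.additive (map_poly d)"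
  by (auto simp: additive_def poly_eq_iff coeff_map_poly additive.zero)

lemmas additive_intros = additive_plus additive_minus additive_uminus additive_id additive_pCons
  additive_const_poly additive_map_poly

text \<open>
  The way in which all identities on \<open>k[\<partial>]A\<close> are reduced to \<open>A\<close>: \<open>F\<close> is the defect of an identity
  and \<open>pCons 0\<close> is \<open>\<partial>\<close>.
\<close>

lemma additive_poly_eqI:
  assumes "Modules.additive F" "\<And>a. F [:a:] = 0" "\<And>p. F p = 0 \<Longrightarrow> F (pCons 0 p) = 0"
  shows "F p = 0"
proof (induction p)
  case 0
  show ?case by (rule additive.zero[OF assms(1)])
next
  case (pCons a p)
  have "pCons a p = [:a:] + pCons 0 p" by simp
  thus ?case using assms pCons.IH by (simp only: additive.add add_0_left)
qed

lemma additive_subst_minus: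
  assumes "Modules.additive d"
  shows "Modules.additive (subst_minus d)"
  unfolding subst_minus_def
  by (intro additive_subst additive_intros assms)

lemma subst_minus_pCons:
  assumes "Modules.additive d"
  shows "subst_minus d (pCons a p) = [:a:] - pCons 0 (subst_minus d p) - map_poly d (subst_minus d p)"
  unfolding subst_minus_def
  by (subst subst_pCons) (intro additive_intros assms | simp)+

lemma subst_minus_zero: "subst_minus d 0 = 0"
  by (simp add: subst_minus_def subst_zero)

lemma subst_minus_map_poly:
  assumes d: "Modules.additive d"
  shows "subst_minus d (map_poly d p) = map_poly d (subst_minus d p)"
proof (induction p)
  case 0
  show ?case by (simp add: subst_minus_zero)
next
  case (pCons a p)
  note add = additive_map_poly[OF d]
  have [simp]: "d 0 = 0" by (rule additive.zero[OF d])
  show ?case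
    by (simp add: map_poly_pCons subst_minus_pCons[OF d] pCons.IH additive.diff[OF add] additive.minus[OF add])
qed

section \<open>Polynomials acting through an operator\<close>

text \<open>
  The common form of the two \<open>k[\<partial>]\<close>-actions, \<open>poly_smult\<close> on \<open>R\<close> and \<open>tensor_smult\<close> on \<open>R \<otimes> R\<close>.
\<close>

definition operator_action ::
  "('k::field \<Rightarrow> 'v::ab_group_add \<Rightarrow> 'v) \<Rightarrow> ('v \<Rightarrow> 'v) \<Rightarrow> 'k poly \<Rightarrow> 'v \<Rightarrow> 'v" where
  "operator_action sc X q v = (\<Sum>n\<le>degree q. sc (coeff q n) ((X ^^ n) v))"

context
  fixes sc :: "'k::field \<Rightarrow> 'v::ab_group_add \<Rightarrow> 'v" and X :: "'v \<Rightarrow> 'v"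
  assumes X: "Vector_Spaces.linear sc sc X"
begin

lemma operator_action_zero: "operator_action sc X 0 v = 0"
proof -
  interpret Vector_Spaces.linear sc sc X by (rule X)
  show ?thesis by (simp add: operator_action_def)
qed

lemma operator_action_pCons: "operator_action sc X (pCons c q) v = sc c v + X (operator_action sc X q v)"
proof -
  interpret Vector_Spaces.linear sc sc X by (rule X)
  have "operator_action sc X (pCons c q) v
      = (\<Sum>n\<le>Suc (degree q). sc (coeff (pCons c q) n) ((X ^^ n) v))"
    unfolding operator_action_def
    by (rule sum.mono_neutral_left) (auto simp: coeff_eq_0 degree_pCons_le)
  also have "\<dots> = sc c v + X (operator_action sc X q v)"
    by (subst sum.atMost_Suc_shift) (simp add: operator_action_def sum scale)
  finally show ?thesis .
qed

lemma module_operator_action: "module (operator_action sc X)"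
proof -
  interpret Vector_Spaces.linear sc sc X by (rule X)
  note [simp] = operator_action_zero operator_action_pCons
  have add_left: "operator_action sc X (q + r) v = operator_action sc X q v + operator_action sc X r v"
    for q r v
  proof (induction q arbitrary: r)
    case (pCons c q)
    show ?case by (cases r) (simp add: pCons.IH add vs1.scale_left_distrib)
  qed simp
  have add_right: "operator_action sc X q (v + w) = operator_action sc X q v + operator_action sc X q w"
    for q v w
    by (induction q) (simp_all add: add vs1.scale_right_distrib)
  have smult: "operator_action sc X (Polynomial.smult c q) v = sc c (operator_action sc X q v)" for c q v
    by (induction q) (simp_all add: scale vs1.scale_right_distrib)
  have "operator_action sc X q (operator_action sc X r v) = operator_action sc X (q * r) v" for q r v
    by (induction q) (simp_all add: add_left smult)
  moreover have "operator_action sc X 1 v = v" for v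
    by (simp add: one_pCons)
  ultimately show ?thesis
    by unfold_locales (simp_all add: add_left add_right)
qed

end

section \<open>The free module \<open>k[\<partial>]A\<close>\<close>

lemma vector_space_map_poly:
  fixes s :: "'k::field \<Rightarrow> 'a::ab_group_add \<Rightarrow> 'a"
  assumes "vector_space s"
  shows "vector_space (\<lambda>c. map_poly (s c))"
proof -
  interpret vector_space s by fact
  show ?thesis
    by unfold_locales
       (simp_all add: poly_eq_iff coeff_map_poly scale_right_distrib scale_left_distrib)
qed

lemma linear_iff_additive:
  "Vector_Spaces.linear s1 s2 f \<longleftrightarrow>
     vector_space s1 \<and> vector_space s2 \<and> Modules.additive f \<and> (\<forall>c x. f (s1 c x) = s2 c (f x))"
  by (auto simp: Vector_Spaces.linear_iff additive_def)

lemma linear_additive: "Vector_Spaces.linear s1 s2 f \<Longrightarrow> Modules.additive f"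
  by (simp add: linear_iff_additive)

lemma linear_shift:
  fixes s :: "'k::field \<Rightarrow> 'a::ab_group_add \<Rightarrow> 'a"
  assumes "vector_space s"
  shows "Vector_Spaces.linear (\<lambda>c. map_poly (s c)) (\<lambda>c. map_poly (s c)) (pCons 0)"
proof -
  interpret vector_space s by fact
  show ?thesis
    by (simp add: Vector_Spaces.linear_iff vector_space_map_poly assms map_poly_pCons)
qed

lemma poly_smult_eq_operator_action:
  fixes s :: "'k::field \<Rightarrow> 'a::ab_group_add \<Rightarrow> 'a"
  assumes "vector_space s"
  shows "poly_smult s = operator_action (\<lambda>c. map_poly (s c)) (pCons 0)"
proof (intro ext)
  interpret vector_space s by fact
  fix q p
  have "map_poly (s c) ((pCons 0 ^^ i) p) = (\<Sum>j\<le>degree p. monom (s c (coeff p j)) (i + j))" for c i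
  proof -
    have add: "Modules.additive (\<lambda>p. map_poly (s c) ((pCons 0 ^^ i) p))"
      by (intro additive_comp[OF additive_map_poly] additive_funpow additive_pCons)
         (simp add: additive_def scale_right_distrib)
    have "map_poly (s c) ((pCons 0 ^^ i) (monom a j)) = monom (s c a) (i + j)" for a j
      by (induction i) (simp_all add: map_poly_pCons map_poly_monom monom_Suc)
    thus ?thesis
      using additive.sum[OF add, of "\<lambda>j. monom (coeff p j) j" "{..degree p}"]
      by (simp add: poly_as_sum_of_monoms)
  qed
  thus "poly_smult s q p = operator_action (\<lambda>c. map_poly (s c)) (pCons 0) q p"
    by (simp add: poly_smult_def operator_action_def)
qed

lemma kscale_poly_smult:
  assumes "vector_space s"
  shows "kscale (poly_smult s) = (\<lambda>c. map_poly (s c))"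
  by (intro ext)
     (simp add: kscale_def poly_smult_eq_operator_action assms operator_action_def)

lemma der_poly_smult:
  fixes s :: "'k::field \<Rightarrow> 'a::ab_group_add \<Rightarrow> 'a"
  assumes "vector_space s"
  shows "der (poly_smult s) = pCons 0"
proof -
  interpret vector_space s by fact
  have "map_poly (s 0) p = 0" "map_poly (s 1) p = p" for p
    by (simp_all add: poly_eq_iff coeff_map_poly)
  thus ?thesis
    by (intro ext)
       (simp add: der_def poly_smult_eq_operator_action assms operator_action_def)
qed

lemma poly_smult_pCons:
  assumes "vector_space s"
  shows "poly_smult s (pCons c q) p = map_poly (s c) p + pCons 0 (poly_smult s q p)"
  by (simp add: poly_smult_eq_operator_action assms operator_action_pCons linear_shift)

lemma module_poly_smult: "vector_space s \<Longrightarrow> module (poly_smult s)"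
  by (simp add: poly_smult_eq_operator_action module_operator_action linear_shift)

lemma fg_module_poly_smult:
  fixes s :: "'k::field \<Rightarrow> 'a::ab_group_add \<Rightarrow> 'a"
  assumes "finite_dimensional_vector_space s B"
  shows "fg_module (poly_smult s)"
proof -
  interpret finite_dimensional_vector_space s B by fact
  have vs: "vector_space s" by unfold_locales
  interpret R: module "poly_smult s" by (rule module_poly_smult[OF vs])
  let ?S = "(\<lambda>b. [:b:]) ` B"
  have const: "[:a:] \<in> R.span ?S" for a
  proof -
    have "a \<in> span B" by (simp add: span_Basis)
    thus ?thesis
    proof (induction rule: span_induct_alt)
      case base
      show ?case by (simp add: R.span_zero)
    next
      case (step c x y)
      have "[:s c x + y:] = poly_smult s [:c:] [:x:] + [:y:]"
        using fun_cong[OF kscale_poly_smult[OF vs], of c]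
        by (simp add: kscale_def map_poly_pCons)
      thus ?case using step by (simp add: R.span_add R.span_scale R.span_base)
    qed
  qed
  have "p \<in> R.span ?S" for p
  proof (induction p)
    case (pCons a p)
    have "pCons a p = [:a:] + poly_smult s [:0, 1:] p"
      using fun_cong[OF der_poly_smult[OF vs], of p] by (simp add: der_def)
    thus ?case using const pCons.IH by (metis R.span_add R.span_scale)
  qed (simp add: R.span_zero)
  thus ?thesis using R.module_axioms finite_Basis by (auto simp: fg_module_def)
qed

section \<open>Sesquilinear brackets\<close>

definition sesquilinear :: "('a::ab_group_add poly \<Rightarrow> 'a poly \<Rightarrow> 'a poly poly) \<Rightarrow> bool" where
  "sesquilinear br \<longleftrightarrow>
     (\<forall>b. Modules.additive (\<lambda>a. br a b)) \<and> (\<forall>a. Modules.additive (br a)) \<and>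
     (\<forall>a b. br (pCons 0 a) b = - pCons 0 (br a b)) \<and>
     (\<forall>a b. br a (pCons 0 b) = pCons 0 (br a b) + map_poly (pCons 0) (br a b))"

lemma sesquilinearD:
  assumes "sesquilinear br"
  shows "Modules.additive (\<lambda>a. br a b)" "Modules.additive (br a)"
    "br (pCons 0 a) b = - pCons 0 (br a b)"
    "br a (pCons 0 b) = pCons 0 (br a b) + map_poly (pCons 0) (br a b)"
    "br 0 b = 0" "br a 0 = 0"
  using assms additive.zero[of "br a"] additive.zero[of "\<lambda>a. br a b"] by (auto simp: sesquilinear_def)

lemma map_poly_pCons0_commute: "map_poly (pCons 0) (pCons 0 w) = pCons 0 (map_poly (pCons 0) w)"
  by (simp add: map_poly_pCons)

lemma skew_symmetric_if_constants:
  assumes br: "sesquilinear br"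
    and const: "\<And>a b. br [:a:] [:b:] = - subst_minus (pCons 0) (br [:b:] [:a:])"
  shows "br p q = - subst_minus (pCons 0) (br q p)"
proof -
  note D = sesquilinearD[OF br]
  note sm = additive_subst_minus[OF additive_pCons]
  note mp = additive_map_poly[OF additive_pCons]
  note [simp] = additive.add[OF sm] additive.minus[OF sm] additive.add[OF mp] additive.minus[OF mp]
    subst_minus_pCons[OF additive_pCons] subst_minus_map_poly[OF additive_pCons] D(3-6)
  define F where "F p q = br p q + subst_minus (pCons 0) (br q p)" for p q
  have add1: "Modules.additive (\<lambda>p. F p q)" and add2: "Modules.additive (F p)" for p q
    unfolding F_def by (intro additive_plus additive_comp[OF sm] D)+
  have 1: "F (pCons 0 p) q = - pCons 0 (F p q)" for p q
    by (simp add: F_def)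
  have 2: "F p (pCons 0 q) = pCons 0 (F p q) + map_poly (pCons 0) (F p q)" for p q
    by (simp add: F_def algebra_simps)
  have "F [:a:] [:b:] = 0" for a b
    using const[of a b] by (simp add: F_def)
  hence "F [:a:] q = 0" for a
    by (rule additive_poly_eqI[OF add2]) (simp_all add: 2)
  hence "F p q = 0"
    by (rule additive_poly_eqI[OF add1]) (simp_all add: 1)
  thus ?thesis by (simp add: F_def eq_neg_iff_add_eq_0)
qed

text \<open>
  The terms \<open>[a\<^sub>\<lambda> [b\<^sub>\<mu> c]]\<close>, \<open>[[a\<^sub>\<lambda> b]\<^sub>\<lambda>\<^sub>+\<^sub>\<mu> c]\<close> and \<open>[b\<^sub>\<mu> [a\<^sub>\<lambda> c]]\<close> of the Jacobi identity; \<open>pCons 0\<close> is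
  multiplication by the outer variable \<open>\<mu>\<close>, and \<open>map_poly (pCons 0)\<close> multiplication by \<open>\<lambda>\<close>.
\<close>

definition jac1 where
  "jac1 br a b c = subst (pCons 0) (\<lambda>d. [:br a d:]) (br b c)"

definition jac2 where
  "jac2 br a b c = subst (map_poly (pCons 0))
     (\<lambda>d. subst (\<lambda>w. map_poly (pCons 0) w + pCons 0 w) (\<lambda>e. [:[:e:]:]) (br d c)) (br a b)"

definition jac3 where
  "jac3 br a b c = subst (map_poly (pCons 0))
     (\<lambda>d. subst (pCons 0) (\<lambda>e. [:[:e:]:]) (br b d)) (br a c)"

text \<open>
  Each of the three terms is multiplied by \<open>-\<lambda>\<close>, \<open>-\<mu>\<close> and \<open>\<lambda> + \<mu> + \<partial>\<close> when \<open>\<partial>\<close> is applied to the first,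
  second and third argument respectively.
\<close>

lemma jacobi_if_constants:
  fixes br :: "'a::ab_group_add poly \<Rightarrow> 'a poly \<Rightarrow> 'a poly poly"
  assumes br: "sesquilinear br"
    and const: "\<And>a b c. jac1 br [:a:] [:b:] [:c:] = jac2 br [:a:] [:b:] [:c:] + jac3 br [:a:] [:b:] [:c:]"
  shows "jac1 br p q r = jac2 br p q r + jac3 br p q r"
proof -
  note D = sesquilinearD[OF br]
  \<comment> \<open>multiplication by \<open>\<mu>\<close>, multiplication by \<open>\<lambda>\<close>, and \<open>\<partial>\<close> acting on coefficients\<close>
  let ?M = "pCons 0 :: 'a poly poly poly \<Rightarrow> _"
  let ?L = "map_poly (pCons 0) :: 'a poly poly poly \<Rightarrow> _"
  let ?P = "map_poly (map_poly (pCons 0)) :: 'a poly poly poly \<Rightarrow> _"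
  have M: "Modules.additive ?M" and L: "Modules.additive ?L" and P: "Modules.additive ?P"
    and LM: "Modules.additive (\<lambda>w. ?L w + ?M w)"
    by (intro additive_intros)+
  have LM_comm: "?L (?M w) = ?M (?L w)" and PM_comm: "?P (?M w) = ?M (?P w)"
    and PL_comm: "?P (?L w) = ?L (?P w)" for w
    by (simp_all add: map_poly_pCons poly_eq_iff coeff_map_poly coeff_pCons split: nat.splits)
  have CC: "Modules.additive (\<lambda>e::'a poly. [:[:e:]:])"
    by (intro additive_comp[OF additive_const_poly additive_const_poly])
  define f1 where "f1 a = (\<lambda>d. [:br a d:])" for a
  define f2 where "f2 c = (\<lambda>d. subst (\<lambda>w. ?L w + ?M w) (\<lambda>e. [:[:e:]:]) (br d c))" for c
  define f3 where "f3 b = (\<lambda>d. subst ?M (\<lambda>e. [:[:e:]:]) (br b d))" for b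
  have f1: "Modules.additive (f1 a)" "Modules.additive (\<lambda>a. f1 a d)" for a d
    unfolding f1_def by (intro additive_comp[OF additive_const_poly] D)+
  have f2: "Modules.additive (f2 a)" "Modules.additive (\<lambda>a. f2 a d)" for a d
    unfolding f2_def by (intro additive_comp[OF additive_subst[OF LM CC]] D)+
  have f3: "Modules.additive (f3 a)" "Modules.additive (\<lambda>a. f3 a d)" for a d
    unfolding f3_def by (intro additive_comp[OF additive_subst[OF M CC]] D)+
  have J: "jac1 br a b c = subst ?M (f1 a) (br b c)" "jac2 br a b c = subst ?L (f2 c) (br a b)"
    "jac3 br a b c = subst ?L (f3 b) (br a c)" for a b c
    by (simp_all add: jac1_def jac2_def jac3_def f1_def f2_def f3_def)
  note [simp] = additive.add[OF L] additive.minus[OF L]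
    additive.add[OF P] additive.minus[OF P] additive.diff[OF L] additive.diff[OF P]
    additive.zero[OF f1(1)] additive.zero[OF f2(1)] additive.zero[OF f3(1)]
  have f1_der: "f1 (pCons 0 a) = (\<lambda>d. - ?L (f1 a d))" "f1 a (pCons 0 d) = ?L (f1 a d) + ?P (f1 a d)" for a d
    by (simp_all add: f1_def D map_poly_pCons)
  have f2_der: "f2 c (pCons 0 d) = - (?L (f2 c d) + ?M (f2 c d))" for c d
    using additive.minus[OF additive_subst[OF LM CC]]
    by (simp add: f2_def D subst_pCons[OF LM])
  have f2_der': "f2 (pCons 0 c) = (\<lambda>d. ?L (f2 c d) + ?M (f2 c d) + ?P (f2 c d))" for c
    using subst_commute[where X = "\<lambda>w. ?L w + ?M w" and Y = ?P and f = "\<lambda>e. [:[:e:]:]", OF LM P]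
    by (simp add: f2_def D subst_pCons[OF LM] additive.add[OF additive_subst[OF LM CC]]
        subst_map_poly[OF LM] PM_comm PL_comm map_poly_pCons)
  have f3_der: "f3 b (pCons 0 d) = ?M (f3 b d) + ?P (f3 b d)" for b d
    using subst_commute[where X = ?M and Y = ?P and f = "\<lambda>e. [:[:e:]:]", OF M P]
    by (simp add: f3_def D subst_pCons[OF M] additive.add[OF additive_subst[OF M CC]]
        subst_map_poly[OF M] PM_comm map_poly_pCons)
  have f3_der': "f3 (pCons 0 b) = (\<lambda>d. - ?M (f3 b d))" for b
    by (simp add: f3_def D subst_pCons[OF M] additive.minus[OF additive_subst[OF M CC]])
  define F where "F p q r = jac1 br p q r - (jac2 br p q r + jac3 br p q r)" for p q r
  have add1: "Modules.additive (\<lambda>p. F p q r)" for q r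
    unfolding F_def J by (intro additive_plus additive_minus additive_subst_fun M f1
        additive_comp[OF additive_subst[OF L f2(1)]] additive_comp[OF additive_subst[OF L f3(1)]] D)
  have add2: "Modules.additive (\<lambda>q. F p q r)" for p r
    unfolding F_def J by (intro additive_plus additive_minus additive_subst_fun L f3
        additive_comp[OF additive_subst[OF M f1(1)]] additive_comp[OF additive_subst[OF L f2(1)]] D)
  have add3: "Modules.additive (\<lambda>r. F p q r)" for p q
    unfolding F_def J by (intro additive_plus additive_minus additive_subst_fun L f2
        additive_comp[OF additive_subst[OF M f1(1)]] additive_comp[OF additive_subst[OF L f3(1)]] D)
  note [simp] = subst_map_poly[OF M, of "f1 _"] subst_map_poly[OF L, of "f2 _"] subst_map_poly[OF L, of "f3 _"]
    subst_pCons[OF M, of "f1 _"] subst_pCons[OF L, of "f2 _"] subst_pCons[OF L, of "f3 _"]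
    additive.add[OF additive_subst[OF M f1(1)]] additive.add[OF additive_subst[OF L f2(1)]]
    additive.add[OF additive_subst[OF L f3(1)]]
    additive.minus[OF additive_subst[OF M f1(1)]] additive.minus[OF additive_subst[OF L f2(1)]]
    additive.minus[OF additive_subst[OF L f3(1)]]
  have zero: "f1 a 0 = 0" "f2 a 0 = 0" "f3 a 0 = 0" for a
    by simp_all
  have 1: "F (pCons 0 p) q r = - ?L (F p q r)" for p q r
  proof -
    have "subst ?M (f1 (pCons 0 p)) w = - ?L (subst ?M (f1 p) w)" for w
      using subst_commute[where X = ?M and Y = "\<lambda>w. - ?L w" and f = "f1 p" and p = w,
          OF M additive_uminus[OF L] zero(1)] by (simp add: f1_der LM_comm)
    thus ?thesis by (simp add: F_def J D additive.diff[OF L])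
  qed
  have 2: "F p (pCons 0 q) r = - ?M (F p q r)" for p q r
  proof -
    have "subst ?L (\<lambda>d. f2 r (pCons 0 d)) w = - (?L (subst ?L (f2 r) w) + ?M (subst ?L (f2 r) w))" for w
      using subst_commute[where X = ?L and Y = "\<lambda>w. - (?L w + ?M w)" and f = "f2 r" and p = w,
          OF L additive_uminus[OF LM] zero(2)] by (simp add: f2_der LM_comm)
    moreover have "subst ?L (f3 (pCons 0 q)) w = - ?M (subst ?L (f3 q) w)" for w
      using subst_commute[where X = ?L and Y = "\<lambda>w. - ?M w" and f = "f3 q" and p = w,
          OF L additive_uminus[OF M] zero(3)] by (simp add: f3_der' LM_comm)
    ultimately show ?thesis by (simp add: F_def J D)
  qed
  have 3: "F p q (pCons 0 r) = ?L (F p q r) + ?M (F p q r) + ?P (F p q r)" for p q r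
  proof -
    have "subst ?M (\<lambda>d. f1 p (pCons 0 d)) w = ?L (subst ?M (f1 p) w) + ?P (subst ?M (f1 p) w)" for w
      using subst_commute[where X = ?M and Y = "\<lambda>w. ?L w + ?P w" and f = "f1 p" and p = w,
          OF M additive_plus[OF L P] zero(1)] by (simp add: f1_der LM_comm PM_comm)
    moreover have "subst ?L (f2 (pCons 0 r)) w
        = ?L (subst ?L (f2 r) w) + ?M (subst ?L (f2 r) w) + ?P (subst ?L (f2 r) w)" for w
      using subst_commute[where X = ?L and Y = "\<lambda>w. ?L w + ?M w + ?P w" and f = "f2 r" and p = w,
          OF L additive_plus[OF LM P] zero(2)] by (simp add: f2_der' LM_comm PL_comm)
    moreover have "subst ?L (\<lambda>d. f3 q (pCons 0 d)) w = ?M (subst ?L (f3 q) w) + ?P (subst ?L (f3 q) w)" for w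
      using subst_commute[where X = ?L and Y = "\<lambda>w. ?M w + ?P w" and f = "f3 q" and p = w,
          OF L additive_plus[OF M P] zero(3)] by (simp add: f3_der LM_comm PL_comm)
    ultimately show ?thesis
      by (simp add: F_def J D additive.diff[OF L] additive.diff[OF P] algebra_simps)
  qed
  have "F [:a:] [:b:] [:c:] = 0" for a b c
    using const[of a b c] by (simp add: F_def)
  hence "F [:a:] [:b:] r = 0" for a b
    by (rule additive_poly_eqI[OF add3]) (simp_all add: 3)
  hence "F [:a:] q r = 0" for a
    by (rule additive_poly_eqI[OF add2]) (simp_all add: 2)
  hence "F p q r = 0"
    by (rule additive_poly_eqI[OF add1]) (simp_all add: 1)
  thus ?thesis by (simp add: F_def)
qed

section \<open>The Lie conformal algebra of a Novikov algebra\<close>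

locale novikov =
  fixes s :: "'k::field \<Rightarrow> 'a::ab_group_add \<Rightarrow> 'a" and m :: "'a \<Rightarrow> 'a \<Rightarrow> 'a"
  assumes novikov: "novikov_algebra s m"
begin

lemma vs: "vector_space s"
  using novikov by (auto simp: novikov_algebra_def finite_dimensional_vector_space_def)

sublocale vector_space s by (rule vs)

lemma m_linear:
  "m (x + y) z = m x z + m y z" "m x (y + z) = m x y + m x z"
  "m (s c x) y = s c (m x y)" "m x (s c y) = s c (m x y)"
  using novikov by (auto simp: novikov_algebra_def bilinear_map_def Vector_Spaces.linear_iff)

lemma star_linear:
  "star m (x + y) z = star m x z + star m y z" "star m x (y + z) = star m x y + star m x z"
  "star m (s c x) y = s c (star m x y)" "star m x (s c y) = s c (star m x y)"
  by (simp_all add: star_def m_linear scale_right_distrib algebra_simps)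

lemma m_left_symmetric: "m (m a b) c - m a (m b c) = m (m b a) c - m b (m a c)"
  and m_right_comm: "m (m a b) c = m (m a c) b"
  using novikov unfolding novikov_algebra_def by blast+

lemma m_left_symmetric': "m a (m b c) = m (m a b) c - m (m b a) c + m b (m a c)"
  using m_left_symmetric[of a b c] by (simp add: algebra_simps)

abbreviation "br \<equiv> novikov_bracket m"

text \<open>
  The bracket on \<open>A \<times> A\<close> and on \<open>A \<times> R\<close>.  With the second one named, the bracket on \<open>R \<times> R\<close> is a single
  substitution \<open>\<partial> \<mapsto> -\<lambda>\<close> in the first argument (\<open>bracket_eq\<close>).
\<close>

definition br_const :: "'a \<Rightarrow> 'a \<Rightarrow> 'a poly poly" where
  "br_const a b = [:[:0, m b a:], [:star m a b:]:]"

definition br_left :: "'a \<Rightarrow> 'a poly \<Rightarrow> 'a poly poly" where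
  "br_left a = subst (\<lambda>w. pCons 0 w + map_poly (pCons 0) w) (br_const a)"

lemma bracket_eq: "br p q = subst (\<lambda>w. - pCons 0 w) (\<lambda>a. br_left a q) p"
  by (simp add: novikov_bracket_def br_left_def br_const_def[abs_def])

lemma additive_br_const: "Modules.additive (br_const a)" "Modules.additive (\<lambda>a. br_const a b)"
  by (simp_all add: additive_def br_const_def m_linear star_linear)

lemma additive_br_left: "Modules.additive (br_left a)" "Modules.additive (\<lambda>a. br_left a q)"
  unfolding br_left_def
  by (intro additive_subst additive_subst_fun additive_intros additive_br_const)+

lemma br_left_pCons: "br_left a (pCons b q) = br_const a b + (pCons 0 (br_left a q) + map_poly (pCons 0) (br_left a q))"
  unfolding br_left_def
  by (rule subst_pCons) (intro additive_intros additive.zero[OF additive_br_const(1)])+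

lemma bracket_pCons: "br (pCons a p) q = br_left a q - pCons 0 (br p q)"
  unfolding bracket_eq
  by (subst subst_pCons) (intro additive_intros additive.zero[OF additive_br_left(2)] | simp)+

lemma bracket_const: "br [:a:] [:b:] = br_const a b"
  by (simp add: novikov_bracket_const br_const_def)

lemma sesquilinear_bracket: "sesquilinear br"
proof -
  let ?X = "\<lambda>w :: 'a poly poly. - pCons 0 w"
  let ?Y = "\<lambda>w :: 'a poly poly. pCons 0 w + map_poly (pCons 0) w"
  have X: "Modules.additive ?X" and Y: "Modules.additive ?Y"
    by (intro additive_intros)+
  note L = additive_map_poly[OF additive_pCons]
  have "br (pCons 0 p) q = - pCons 0 (br p q)" for p q
    using bracket_pCons[of 0 p q] additive.zero[OF additive_br_left(2)] by simp
  moreover have "br p (pCons 0 q) = ?Y (br p q)" for p q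
  proof -
    have "br p (pCons 0 q) = subst ?X (\<lambda>a. ?Y (br_left a q)) p"
      by (simp add: bracket_eq br_left_pCons additive.zero[OF additive_br_const(1)])
    also have "\<dots> = ?Y (br p q)"
      unfolding bracket_eq
      by (rule subst_commute[OF X Y])
         (simp_all add: additive.zero[OF additive_br_left(2)] additive.minus[OF L] map_poly_pCons0_commute)
    finally show ?thesis .
  qed
  moreover have "Modules.additive (\<lambda>p. br p q)" "Modules.additive (br p)" for p q
    unfolding bracket_eq
    by (intro additive_subst additive_subst_fun X additive_br_left)+
  ultimately show ?thesis by (simp add: sesquilinear_def)
qed

lemmas br_sesqui = sesquilinearD[OF sesquilinear_bracket]

lemma bracket_scale:
  "br (map_poly (s c) p) q = map_poly (map_poly (s c)) (br p q)"
  "br p (map_poly (s c) q) = map_poly (map_poly (s c)) (br p q)"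
proof -
  have S: "Modules.additive (map_poly (map_poly (s c)))"
    by (intro additive_map_poly) (simp add: additive_def scale_right_distrib)
  have const: "br [:s c a:] [:b:] = map_poly (map_poly (s c)) (br [:a:] [:b:])"
    "br [:a:] [:s c b:] = map_poly (map_poly (s c)) (br [:a:] [:b:])" for a b
    by (simp_all add: bracket_const br_const_def m_linear star_linear map_poly_pCons)
  have comm: "map_poly (map_poly (s c)) (pCons 0 w) = pCons 0 (map_poly (map_poly (s c)) w)"
    "map_poly (map_poly (s c)) (map_poly (pCons 0) w) = map_poly (pCons 0) (map_poly (map_poly (s c)) w)" for w
    by (simp_all add: map_poly_pCons poly_eq_iff coeff_map_poly coeff_pCons split: nat.splits)
  note [simp] = additive.add[OF S] additive.minus[OF S] additive.diff[OF S] comm br_sesqui(3,4)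
  have sc: "Modules.additive (map_poly (s c))"
    by (intro additive_map_poly) (simp add: additive_def scale_right_distrib)
  show "br (map_poly (s c) p) q = map_poly (map_poly (s c)) (br p q)"
  proof -
    let ?F = "\<lambda>p q. br (map_poly (s c) p) q - map_poly (map_poly (s c)) (br p q)"
    have a1: "Modules.additive (\<lambda>p. ?F p q)" and a2: "Modules.additive (\<lambda>q. ?F p q)" for p q
      by (intro additive_minus additive_comp[OF S] additive_comp[OF br_sesqui(1) sc] br_sesqui(1,2))+
    have "?F [:a:] q = 0" for a
      by (rule additive_poly_eqI[OF a2]) (simp_all add: map_poly_pCons const)
    hence "?F p q = 0"
      by (rule additive_poly_eqI[OF a1]) (simp_all add: map_poly_pCons)
    thus ?thesis by simp
  qed
  show "br p (map_poly (s c) q) = map_poly (map_poly (s c)) (br p q)"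
  proof -
    let ?F = "\<lambda>p q. br p (map_poly (s c) q) - map_poly (map_poly (s c)) (br p q)"
    have a1: "Modules.additive (\<lambda>p. ?F p q)" and a2: "Modules.additive (\<lambda>q. ?F p q)" for p q
      by (intro additive_minus additive_comp[OF S] additive_comp[OF br_sesqui(2) sc] br_sesqui(1,2))+
    have "?F [:a:] q = 0" for a
      by (rule additive_poly_eqI[OF a2]) (simp_all add: map_poly_pCons const)
    hence "?F p q = 0"
      by (rule additive_poly_eqI[OF a1]) (simp_all add: map_poly_pCons)
    thus ?thesis by simp
  qed
qed

lemma bracket_skew: "br p q = - subst_minus (pCons 0) (br q p)"
proof (rule skew_symmetric_if_constants[OF sesquilinear_bracket])
  fix a b
  show "br [:a:] [:b:] = - subst_minus (pCons 0) (br [:b:] [:a:])"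
    by (simp add: bracket_const br_const_def subst_minus_pCons[OF additive_pCons] subst_minus_zero
        map_poly_pCons star_def)
qed

text \<open>
  On \<open>A\<close>, the coefficients at \<open>\<partial>\<^sup>i \<lambda>\<^sup>j \<mu>\<^sup>k\<close>, \<open>i + j + k = 2\<close>, are combinations of triple products.  Right
  commutativity leaves three products of the form \<open>(x \<circ> y) \<circ> z\<close>, and left symmetry removes three of the form
  \<open>x \<circ> (y \<circ> z)\<close>; in terms of the others each coefficient identity is trivial.
\<close>

lemma bracket_jacobi: "jac1 br p q r = jac2 br p q r + jac3 br p q r"
proof (rule jacobi_if_constants[OF sesquilinear_bracket])
  fix a b c
  have [simp]: "br [:x:] [:0, y:] = [:[:0, 0, m y x:], [:0, m y x + star m x y:], [:star m x y:]:]"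
    "br [:0, x:] [:y:] = [:0, [:0, - m y x:], [:- star m x y:]:]"
    "br [:x:] [:y:] = [:[:0, m y x:], [:star m x y:]:]" for x y
    using br_sesqui(3)[of "[:x:]" "[:y:]"] br_sesqui(4)[of "[:x:]" "[:y:]"]
    by (simp_all add: bracket_const br_const_def map_poly_pCons)
  have M: "Modules.additive (pCons (0 :: 'a poly poly))"
    and L: "Modules.additive (map_poly (pCons 0) :: 'a poly poly poly \<Rightarrow> _)"
    and LM: "Modules.additive (\<lambda>w. map_poly (pCons 0) w + pCons (0 :: 'a poly poly) w)"
    by (intro additive_intros)+
  have z[simp]: "br 0 x = 0" "br x 0 = 0" for x by (rule br_sesqui)+
  have 1: "jac1 br [:a:] [:b:] [:c:] =
      [:[:[:0, 0, m (m c b) a:], [:0, m (m c b) a + star m a (m c b):], [:star m a (m c b):]:],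
        [:[:0, m (star m b c) a:], [:star m a (star m b c):]:]:]"
    by (simp add: jac1_def subst_pCons[OF M] subst_zero)
  have 2: "jac2 br [:a:] [:b:] [:c:] =
      [:[:[:0, 0:], [:0, m c (star m a b) - m c (m b a):], [:star m (star m a b) c - star m (m b a) c:]:],
        [:[:0, - m c (m b a):], [:star m (star m a b) c - star m (m b a) c - star m (m b a) c:]:],
        [:[:- star m (m b a) c:]:]:]"
    by (simp add: jac2_def subst_pCons[OF L] subst_zero subst_pCons[OF LM] map_poly_pCons)
  have 3: "jac3 br [:a:] [:b:] [:c:] =
      [:[:[:0, 0, m (m c a) b:], [:0, m (star m a c) b:]:],
        [:[:0, m (m c a) b + star m b (m c a):], [:star m b (star m a c):]:],
        [:[:star m b (m c a):]:]:]"
    by (simp add: jac3_def subst_pCons[OF L] subst_pCons[OF M] subst_zero map_poly_pCons)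
  have rc: "m (m a c) b = m (m a b) c" "m (m b c) a = m (m b a) c" "m (m c b) a = m (m c a) b"
    by (rule m_right_comm)+
  have ls: "m c (m a b) = m (m c a) b - m (m a b) c + m a (m c b)"
    "m c (m b a) = m (m c a) b - m (m b a) c + m b (m c a)"
    "m a (m b c) = m (m a b) c - m (m b a) c + m b (m a c)"
    using m_left_symmetric'[of c a b] m_left_symmetric'[of c b a] m_left_symmetric'[of a b c]
    by (simp_all only: rc)
  show "jac1 br [:a:] [:b:] [:c:] = jac2 br [:a:] [:b:] [:c:] + jac3 br [:a:] [:b:] [:c:]"
    unfolding 1 2 3
    by (simp add: star_def m_linear) (simp add: rc ls algebra_simps)
qed

lemma lie_conformal_algebra_bracket: "lie_conformal_algebra (poly_smult s) br"
proof -
  obtain B where B: "finite_dimensional_vector_space s B"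
    using novikov by (auto simp: novikov_algebra_def)
  have "bilinear_map (\<lambda>c. map_poly (s c)) (\<lambda>c. map_poly (s c)) (\<lambda>c. map_poly (map_poly (s c))) br"
    unfolding bilinear_map_def linear_iff_additive
    by (simp add: vs vector_space_map_poly br_sesqui bracket_scale)
  thus ?thesis
    unfolding lie_conformal_algebra_def Let_def kscale_poly_smult[OF vs] der_poly_smult[OF vs]
    using fg_module_poly_smult[OF B] br_sesqui(3,4) bracket_skew
      bracket_jacobi[unfolded jac1_def jac2_def jac3_def]
    by blast
qed

end

section \<open>Multilinear forms and Sweedler notation\<close>

lemma bilinear_form_iff:
  "bilinear_map s1 s2 (*) \<beta> \<longleftrightarrow> vector_space s1 \<and> vector_space s2 \<and>
     (\<forall>x y z. \<beta> (x + y) z = \<beta> x z + \<beta> y z) \<and> (\<forall>x y z. \<beta> x (y + z) = \<beta> x y + \<beta> x z) \<and>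
     (\<forall>c x y. \<beta> (s1 c x) y = c * \<beta> x y) \<and> (\<forall>c x y. \<beta> x (s2 c y) = c * \<beta> x y)"
  by (auto simp: bilinear_map_def Vector_Spaces.linear_iff vector_space_mult)

lemma trilinear_form_iff:
  "trilinear_map s (*) \<beta> \<longleftrightarrow> vector_space s \<and>
     (\<forall>x y z w. \<beta> (x + y) z w = \<beta> x z w + \<beta> y z w) \<and> (\<forall>c x y z. \<beta> (s c x) y z = c * \<beta> x y z) \<and>
     (\<forall>x y z w. \<beta> x (y + z) w = \<beta> x y w + \<beta> x z w) \<and> (\<forall>c x y z. \<beta> x (s c y) z = c * \<beta> x y z) \<and>
     (\<forall>x y z w. \<beta> x y (z + w) = \<beta> x y z + \<beta> x y w) \<and> (\<forall>c x y z. \<beta> x y (s c z) = c * \<beta> x y z)"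
  by (auto simp: trilinear_map_def Vector_Spaces.linear_iff vector_space_mult)

lemma bilinear_form_pullback:
  assumes "bilinear_map s1 s2 (*) \<beta>" "Vector_Spaces.linear t1 s1 f" "Vector_Spaces.linear t2 s2 g"
  shows "bilinear_map t1 t2 (*) (\<lambda>x y. \<beta> (f x) (g y))"
  using assms by (simp add: bilinear_form_iff Vector_Spaces.linear_iff)

lemma trilinear_form_pullback:
  assumes "trilinear_map s (*) \<beta>" "Vector_Spaces.linear t s f" "Vector_Spaces.linear t s g"
    "Vector_Spaces.linear t s h"
  shows "trilinear_map t (*) (\<lambda>x y z. \<beta> (f x) (g y) (h z))"
  using assms by (simp add: trilinear_form_iff Vector_Spaces.linear_iff)

text \<open>
  In the first argument these are equations between functions, because a term
  \<open>\<lambda>x y. \<beta> (f x) y\<close> appears \<open>\<eta>\<close>-contracted as \<open>\<lambda>x. \<beta> (f x)\<close>.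
\<close>

lemma bilinear_form_linear:
  assumes "bilinear_map s1 s2 (*) \<beta>"
  shows "\<beta> (x + y) = (\<lambda>z. \<beta> x z + \<beta> y z)" "\<beta> x (z + w) = \<beta> x z + \<beta> x w"
    "\<beta> (- x) = (\<lambda>z. - \<beta> x z)" "\<beta> x (- z) = - \<beta> x z" "\<beta> 0 = (\<lambda>z. 0)" "\<beta> x 0 = 0"
proof -
  have add: "Modules.additive (\<lambda>x. \<beta> x z)" "Modules.additive (\<beta> x)" for x z
    using assms by (simp_all add: additive_def bilinear_form_iff)
  show "\<beta> (x + y) = (\<lambda>z. \<beta> x z + \<beta> y z)" "\<beta> x (z + w) = \<beta> x z + \<beta> x w"
    "\<beta> (- x) = (\<lambda>z. - \<beta> x z)" "\<beta> x (- z) = - \<beta> x z" "\<beta> 0 = (\<lambda>z. 0)" "\<beta> x 0 = 0"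
    by (rule ext additive.add[OF add(1)] additive.add[OF add(2)] additive.minus[OF add(1)]
        additive.minus[OF add(2)] additive.zero[OF add(1)] additive.zero[OF add(2)])+
qed

lemma bilinear_form_flip: "bilinear_map s2 s1 (*) \<beta> \<Longrightarrow> bilinear_map s1 s2 (*) (\<lambda>x y. \<beta> y x)"
  by (simp add: bilinear_form_iff)

lemma bilinear_form_add:
  "bilinear_map s1 s2 (*) \<beta> \<Longrightarrow> bilinear_map s1 s2 (*) \<gamma> \<Longrightarrow> bilinear_map s1 s2 (*) (\<lambda>x y. \<beta> x y + \<gamma> x y)"
  by (simp add: bilinear_form_iff algebra_simps)

lemma bilinear_form_diff:
  "bilinear_map s1 s2 (*) \<beta> \<Longrightarrow> bilinear_map s1 s2 (*) \<gamma> \<Longrightarrow> bilinear_map s1 s2 (*) (\<lambda>x y. \<beta> x y - \<gamma> x y)"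
  by (simp add: bilinear_form_iff algebra_simps)

lemma trilinear_form_perm:
  assumes "trilinear_map s (*) \<beta>"
  shows "trilinear_map s (*) (\<lambda>x y z. \<beta> y x z)" "trilinear_map s (*) (\<lambda>x y z. \<beta> x z y)"
    "trilinear_map s (*) (\<lambda>x y z. \<beta> z x y)" "trilinear_map s (*) (\<lambda>x y z. \<beta> y z x)"
    "trilinear_map s (*) (\<lambda>x y z. \<beta> z y x)"
  using assms by (simp_all add: trilinear_form_iff)

lemma trilinear_form_fix:
  assumes "trilinear_map s (*) \<beta>"
  shows "bilinear_map s s (*) (\<beta> x)" "bilinear_map s s (*) (\<lambda>y z. \<beta> y z x)"
    "bilinear_map s s (*) (\<lambda>y z. \<beta> y x z)"
  using assms by (simp_all add: trilinear_form_iff bilinear_form_iff)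

text \<open>
  Evaluation of a form at \<open>\<Sum> u \<otimes> v\<close>.  It is linear on all functions, whereas an element of
  \<open>tensor_space\<close> vanishes on functions that are not bilinear.
\<close>

definition sweedler :: "('a \<times> 'b) list \<Rightarrow> ('a \<Rightarrow> 'b \<Rightarrow> 'k) \<Rightarrow> 'k::field" where
  "sweedler xs \<beta> = (\<Sum>(u, v)\<leftarrow>xs. \<beta> u v)"

lemma sweedler_linear:
  "sweedler xs (\<lambda>x y. \<beta> x y + \<gamma> x y) = sweedler xs \<beta> + sweedler xs \<gamma>"
  "sweedler xs (\<lambda>x y. \<beta> x y - \<gamma> x y) = sweedler xs \<beta> - sweedler xs \<gamma>"
  "sweedler xs (\<lambda>x y. - \<beta> x y) = - sweedler xs \<beta>"
  "sweedler xs (\<lambda>x y. c * \<beta> x y) = c * sweedler xs \<beta>"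
  "sweedler xs (\<lambda>x y. 0) = 0"
  by (induction xs) (auto simp: sweedler_def algebra_simps)

lemma tensor_space_sweedler:
  fixes s1 :: "'k::field \<Rightarrow> 'a::ab_group_add \<Rightarrow> 'a" and s2 :: "'k \<Rightarrow> 'b::ab_group_add \<Rightarrow> 'b"
  assumes "t \<in> tensor_space s1 s2"
  shows "\<exists>xs. \<forall>\<beta>. t \<beta> = (if bilinear_map s1 s2 (*) \<beta> then sweedler xs \<beta> else 0)"
proof -
  interpret f: vector_space "fscale :: 'k \<Rightarrow> (('a \<Rightarrow> 'b \<Rightarrow> 'k) \<Rightarrow> 'k) \<Rightarrow> _" by (rule vector_space_fscale)
  show ?thesis
    using assms unfolding tensor_space_def
  proof (induction rule: f.span_induct_alt)
    case base
    show ?case by (rule exI[of _ "[]"]) (simp add: sweedler_def)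
  next
    case (step c x y)
    then obtain a b xs where "x = tensor s1 s2 a b"
      and "\<And>\<beta>. y \<beta> = (if bilinear_map s1 s2 (*) \<beta> then sweedler xs \<beta> else 0)" by blast
    thus ?case
      by (intro exI[of _ "(s1 c a, b) # xs"])
         (auto simp: tensor_def fscale_def sweedler_def bilinear_form_iff)
  qed
qed

lemma tensor_space_add:
  assumes "t \<in> tensor_space s1 s2" "bilinear_map s1 s2 (*) \<beta>" "bilinear_map s1 s2 (*) \<gamma>"
  shows "t (\<lambda>x y. \<beta> x y + \<gamma> x y) = t \<beta> + t \<gamma>"
  using tensor_space_sweedler[OF assms(1)] assms bilinear_form_add[OF assms(2,3)]
  by (auto simp: sweedler_linear)

lemma tensor_space_mult:
  assumes "t \<in> tensor_space s1 s2" "bilinear_map s1 s2 (*) \<beta>"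
  shows "t (\<lambda>x y. c * \<beta> x y) = c * t \<beta>"
proof -
  have "bilinear_map s1 s2 (*) (\<lambda>x y. c * \<beta> x y)"
    using assms(2) by (simp add: bilinear_form_iff algebra_simps)
  thus ?thesis
    using tensor_space_sweedler[OF assms(1)] assms by (auto simp: sweedler_linear)
qed

lemma tensor_space_uminus:
  assumes "t \<in> tensor_space s1 s2" "bilinear_map s1 s2 (*) \<beta>"
  shows "t (\<lambda>x y. - \<beta> x y) = - t \<beta>"
  using tensor_space_mult[OF assms, of "-1"] by simp

lemma tensor_space_closed:
  fixes s1 :: "'k::field \<Rightarrow> 'a::ab_group_add \<Rightarrow> 'a" and s2 :: "'k \<Rightarrow> 'b::ab_group_add \<Rightarrow> 'b"
  assumes "t \<in> tensor_space s1 s2" "u \<in> tensor_space s1 s2"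
  shows "t + u \<in> tensor_space s1 s2" "t - u \<in> tensor_space s1 s2"
    "fscale c t \<in> tensor_space s1 s2" "0 \<in> tensor_space s1 s2"
proof -
  interpret f: vector_space "fscale :: 'k \<Rightarrow> (('a \<Rightarrow> 'b \<Rightarrow> 'k) \<Rightarrow> 'k) \<Rightarrow> _" by (rule vector_space_fscale)
  show "t + u \<in> tensor_space s1 s2" "t - u \<in> tensor_space s1 s2"
    "fscale c t \<in> tensor_space s1 s2" "0 \<in> tensor_space s1 s2"
    using assms unfolding tensor_space_def
    by (auto intro: f.span_add f.span_diff f.span_scale f.span_zero)
qed

lemma tensor_map_in_tensor_space:
  fixes s1 :: "'k::field \<Rightarrow> 'a::ab_group_add \<Rightarrow> 'a" and s2 :: "'k \<Rightarrow> 'b::ab_group_add \<Rightarrow> 'b"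
    and s1' :: "'k \<Rightarrow> 'c::ab_group_add \<Rightarrow> 'c" and s2' :: "'k \<Rightarrow> 'd::ab_group_add \<Rightarrow> 'd"
  assumes f: "Vector_Spaces.linear s1 s1' f" and g: "Vector_Spaces.linear s2 s2' g"
    and t: "t \<in> tensor_space s1 s2"
  shows "tensor_map s1' s2' f g t \<in> tensor_space s1' s2'"
proof -
  interpret V: vector_space "fscale :: 'k \<Rightarrow> (('a \<Rightarrow> 'b \<Rightarrow> 'k) \<Rightarrow> 'k) \<Rightarrow> _" by (rule vector_space_fscale)
  interpret W: vector_space "fscale :: 'k \<Rightarrow> (('c \<Rightarrow> 'd \<Rightarrow> 'k) \<Rightarrow> 'k) \<Rightarrow> _" by (rule vector_space_fscale)
  show ?thesis
    using t unfolding tensor_space_def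
  proof (induction rule: V.span_induct_alt)
    case base
    have zero: "tensor_map s1' s2' f g 0 = 0" by (simp add: tensor_map_def fun_eq_iff)
    show ?case unfolding zero by (rule W.span_zero)
  next
    case (step c x y)
    then obtain a b where x: "x = tensor s1 s2 a b" by blast
    have eq: "tensor_map s1' s2' f g (fscale c x + y) = fscale c (tensor s1' s2' (f a) (g b)) + tensor_map s1' s2' f g y"
      unfolding tensor_map_tensor[OF f g, symmetric] x
      by (simp add: tensor_map_def fscale_def fun_eq_iff)
    have mem: "tensor s1' s2' (f a) (g b) \<in> W.span {tensor s1' s2' a b |a b. True}"
      by (rule W.span_base) blast
    show ?case unfolding eq by (intro W.span_add W.span_scale mem step)
  qed
qed

lemma flip2_in_tensor_space:
  fixes s :: "'k::field \<Rightarrow> 'a::ab_group_add \<Rightarrow> 'a"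
  assumes t: "t \<in> tensor_space s s"
  shows "flip2 s t \<in> tensor_space s s"
proof -
  interpret V: vector_space "fscale :: 'k \<Rightarrow> (('a \<Rightarrow> 'a \<Rightarrow> 'k) \<Rightarrow> 'k) \<Rightarrow> _" by (rule vector_space_fscale)
  show ?thesis
    using t unfolding tensor_space_def
  proof (induction rule: V.span_induct_alt)
    case base
    have zero: "flip2 s 0 = 0" by (simp add: flip2_def fun_eq_iff)
    show ?case unfolding zero by (rule V.span_zero)
  next
    case (step c x y)
    then obtain a b where x: "x = tensor s s a b" by blast
    have eq: "flip2 s (fscale c x + y) = fscale c (tensor s s b a) + flip2 s y"
      unfolding flip2_tensor[of s a b, symmetric] x
      by (simp add: flip2_def fscale_def fun_eq_iff)
    have mem: "tensor s s b a \<in> V.span {tensor s s a b |a b. True}"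
      by (rule V.span_base) blast
    show ?case unfolding eq by (intro V.span_add V.span_scale mem step)
  qed
qed

lemma linear_to_tensorD:
  assumes "linear_to_tensor s D"
  shows "D a \<in> tensor_space s s" "D (x + y) \<beta> = D x \<beta> + D y \<beta>" "D (s c x) \<beta> = c * D x \<beta>"
    "vector_space s"
  using assms by (auto simp: linear_to_tensor_def Vector_Spaces.linear_iff fscale_def)

text \<open>
  These make \<open>id_tensor\<close> and \<open>tensor_id\<close> meaningful: a tensor is evaluated there at the form obtained by
  comultiplying one argument, and its value would be \<open>0\<close> if this form were not bilinear.
\<close>

lemma bilinear_comultiplied:
  assumes D: "linear_to_tensor s D" and T: "trilinear_map s (*) \<beta>"
  shows "bilinear_map s s (*) (\<lambda>x y. D y (\<beta> x))"
    and "bilinear_map s s (*) (\<lambda>x y. D x (\<lambda>u v. \<beta> u v y))"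
proof -
  note D' = linear_to_tensorD[OF D]
  have T': "\<beta> (x + y) = (\<lambda>u v. \<beta> x u v + \<beta> y u v)" "\<beta> (s c x) = (\<lambda>u v. c * \<beta> x u v)"
    "\<beta> u v (x + y) = \<beta> u v x + \<beta> u v y" "\<beta> u v (s c x) = c * \<beta> u v x" for x y c u v
    using T by (simp_all add: trilinear_form_iff fun_eq_iff)
  note tf = trilinear_form_fix[OF T]
  note A1 = tensor_space_add[OF D'(1) tf(1) tf(1)] and A2 = tensor_space_add[OF D'(1) tf(2) tf(2)]
    and M1 = tensor_space_mult[OF D'(1) tf(1)] and M2 = tensor_space_mult[OF D'(1) tf(2)]
  show "bilinear_map s s (*) (\<lambda>x y. D y (\<beta> x))"
    unfolding bilinear_form_iff by (simp only: D' T'(1,2) A1 M1 simp_thms)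
  show "bilinear_map s s (*) (\<lambda>x y. D x (\<lambda>u v. \<beta> u v y))"
    unfolding bilinear_form_iff by (simp only: D' T'(3,4) A2 M2 simp_thms)
qed

lemma tens2_eqI:
  assumes "t \<in> tensor_space s1 s2" "u \<in> tensor_space s1 s2"
    "\<And>\<beta>. bilinear_map s1 s2 (*) \<beta> \<Longrightarrow> t \<beta> = u \<beta>"
  shows "t = u"
  using tensor_space_sweedler[OF assms(1)] tensor_space_sweedler[OF assms(2)] assms(3)
  by (metis ext)

section \<open>The cobracket\<close>

locale novikov_comult = novikov s m
  for s :: "'k::field \<Rightarrow> 'a::ab_group_add \<Rightarrow> 'a" and m :: "'a \<Rightarrow> 'a \<Rightarrow> 'a" +
  fixes \<Delta> :: "'a \<Rightarrow> ('a, 'a, 'k) tens2"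
  assumes comult: "linear_to_tensor s \<Delta>"
begin

abbreviation "S \<equiv> \<lambda>c. map_poly (s c)"
abbreviation "\<delta> \<equiv> novikov_cobracket s \<Delta>"
abbreviation "bilinearA \<equiv> bilinear_map s s (*)"
abbreviation "trilinearA \<equiv> trilinear_map s (*)"
abbreviation "bilinearR \<equiv> bilinear_map S S (*)"
abbreviation "trilinearR \<equiv> trilinear_map S (*)"

text \<open>
  \<open>\<Delta>(a)\<close> evaluated through one fixed representation \<open>\<Sum> u \<otimes> v\<close>.  Linearity in the form is thus
  unconditional (\<open>E_linear\<close>), while linearity in \<open>a\<close> requires a bilinear form (\<open>E_linear_arg\<close>).
\<close>

definition E :: "'a \<Rightarrow> ('a \<Rightarrow> 'a \<Rightarrow> 'k) \<Rightarrow> 'k" where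
  "E a = sweedler (SOME xs. \<forall>\<beta>. \<Delta> a \<beta> = (if bilinearA \<beta> then sweedler xs \<beta> else 0))"

lemma comult_eq: "\<Delta> a \<beta> = (if bilinearA \<beta> then E a \<beta> else 0)"
  unfolding E_def
  using someI_ex[OF tensor_space_sweedler[OF linear_to_tensorD(1)[OF comult]], of a] by blast

lemma E_linear:
  "E a (\<lambda>x y. \<beta> x y + \<gamma> x y) = E a \<beta> + E a \<gamma>"
  "E a (\<lambda>x y. \<beta> x y - \<gamma> x y) = E a \<beta> - E a \<gamma>"
  "E a (\<lambda>x y. - \<beta> x y) = - E a \<beta>"
  "E a (\<lambda>x y. 0) = 0"
  by (simp_all add: E_def sweedler_linear)

lemma E_linear_arg:
  assumes "bilinearA \<beta>"
  shows "E (a + b) \<beta> = E a \<beta> + E b \<beta>" "E (s c a) \<beta> = c * E a \<beta>"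
  using linear_to_tensorD(2)[OF comult, of a b \<beta>] linear_to_tensorD(3)[OF comult, of c a \<beta>] assms
  by (simp_all add: comult_eq)

lemma vsR: "vector_space S"
  by (rule vector_space_map_poly[OF vs])

lemma linear_id: "Vector_Spaces.linear s s (\<lambda>x. x)" "Vector_Spaces.linear S S (\<lambda>x. x)"
  by (simp_all add: Vector_Spaces.linear_iff vs vsR)

lemma linear_der: "Vector_Spaces.linear S S (pCons 0)"
  by (rule linear_shift[OF vs])

lemma linear_embed: "Vector_Spaces.linear s S (\<lambda>u. [:u:])" "Vector_Spaces.linear s S (\<lambda>u. [:0, u:])"
  "Vector_Spaces.linear s S (\<lambda>u. [:0, 0, u:])"
  by (simp_all add: Vector_Spaces.linear_iff vs vsR map_poly_pCons)

lemma linear_coeff: "Vector_Spaces.linear S s (\<lambda>p. coeff p i)"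
  by (simp add: Vector_Spaces.linear_iff vs vsR coeff_map_poly)

lemma linear_m: "Vector_Spaces.linear s s (\<lambda>x. m x a)" "Vector_Spaces.linear s s (m a)"
  "Vector_Spaces.linear s s (star m a)"
  by (simp_all add: Vector_Spaces.linear_iff vs m_linear star_linear)

lemmas linear_intros = linear_id linear_der linear_embed linear_m

lemma tensor_der_eq:
  "tensor_der (poly_smult s) t \<beta> =
     (if bilinearR \<beta> then t (\<lambda>x y. \<beta> (pCons 0 x) y) + t (\<lambda>x y. \<beta> x (pCons 0 y)) else 0)"
  by (simp add: tensor_der_def tensor_map_def kscale_poly_smult[OF vs] der_poly_smult[OF vs])

lemma linear_tensor_der: "Vector_Spaces.linear fscale fscale (tensor_der (poly_smult s))"
  unfolding Vector_Spaces.linear_iff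
  by (auto simp: vector_space_fscale fun_eq_iff tensor_der_eq fscale_def algebra_simps)

lemma cobracket_gen_eq:
  "novikov_cobracket_gen s \<Delta> a \<beta> =
     (if bilinearR \<beta> then E a (\<lambda>u v. \<beta> [:0, u:] [:v:] - \<beta> [:v:] [:0, u:]) else 0)"
proof (cases "bilinearR \<beta>")
  case True
  have 1: "bilinearR (\<lambda>x y. \<beta> (pCons 0 x) y)" "bilinearR (\<lambda>x y. \<beta> y x)" "bilinearR (\<lambda>x y. \<beta> y (pCons 0 x))"
    by (intro bilinear_form_pullback[OF True] linear_intros bilinear_form_flip[OF True]
        bilinear_form_flip[where \<beta> = "\<lambda>y x. \<beta> y (pCons 0 x)"])+
  have 2: "bilinearA (\<lambda>u v. \<beta> [:0, u:] [:v:])" "bilinearA (\<lambda>u v. \<beta> [:v:] [:0, u:])"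
    by (intro bilinear_form_pullback[OF True] bilinear_form_pullback[OF 1(2)] linear_intros)+
  show ?thesis
    using True 1 2
    by (simp add: novikov_cobracket_gen_def Let_def tensor_map_def flip2_def kscale_poly_smult[OF vs]
        der_poly_smult[OF vs] comult_eq E_linear)
next
  case False
  thus ?thesis
    by (simp add: novikov_cobracket_gen_def Let_def tensor_map_def flip2_def kscale_poly_smult[OF vs])
qed

lemma additive_cobracket_gen: "Modules.additive (novikov_cobracket_gen s \<Delta>)"
proof
  fix a b
  show "novikov_cobracket_gen s \<Delta> (a + b) = novikov_cobracket_gen s \<Delta> a + novikov_cobracket_gen s \<Delta> b"
  proof
    fix \<beta>
    show "novikov_cobracket_gen s \<Delta> (a + b) \<beta> = (novikov_cobracket_gen s \<Delta> a + novikov_cobracket_gen s \<Delta> b) \<beta>"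
    proof (cases "bilinearR \<beta>")
      case True
      have "bilinearA (\<lambda>u v. \<beta> [:0, u:] [:v:] - \<beta> [:v:] [:0, u:])"
        by (intro bilinear_form_diff bilinear_form_pullback[OF True]
            bilinear_form_pullback[OF bilinear_form_flip[OF True]] linear_intros)
      thus ?thesis by (simp add: cobracket_gen_eq E_linear_arg)
    qed (simp add: cobracket_gen_eq)
  qed
qed

lemma cobracket_gen_scale: "novikov_cobracket_gen s \<Delta> (s c a) = fscale c (novikov_cobracket_gen s \<Delta> a)"
proof
  fix \<beta>
  show "novikov_cobracket_gen s \<Delta> (s c a) \<beta> = fscale c (novikov_cobracket_gen s \<Delta> a) \<beta>"
  proof (cases "bilinearR \<beta>")
    case True
    have "bilinearA (\<lambda>u v. \<beta> [:0, u:] [:v:] - \<beta> [:v:] [:0, u:])"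
      by (intro bilinear_form_diff bilinear_form_pullback[OF True]
          bilinear_form_pullback[OF bilinear_form_flip[OF True]] linear_intros)
    thus ?thesis by (simp add: cobracket_gen_eq E_linear_arg fscale_def)
  qed (simp add: cobracket_gen_eq fscale_def)
qed

lemma tensor_der_in_tensor_space:
  "t \<in> tensor_space S S \<Longrightarrow> tensor_der (poly_smult s) t \<in> tensor_space S S"
  unfolding tensor_der_def kscale_poly_smult[OF vs] der_poly_smult[OF vs] id_def
  by (intro tensor_space_closed tensor_map_in_tensor_space[OF linear_der linear_id(2)]
      tensor_map_in_tensor_space[OF linear_id(2) linear_der])

lemma cobracket_gen_in_tensor_space: "novikov_cobracket_gen s \<Delta> a \<in> tensor_space S S"
  unfolding novikov_cobracket_gen_def Let_def kscale_poly_smult[OF vs] der_poly_smult[OF vs] id_def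
  by (intro tensor_space_closed flip2_in_tensor_space linear_to_tensorD(1)[OF comult]
      tensor_map_in_tensor_space[OF linear_der linear_id(2)]
      tensor_map_in_tensor_space[OF linear_embed(1) linear_embed(1)])

lemma additive_tensor_der: "Modules.additive (tensor_der (poly_smult s))"
  by (rule linear_additive[OF linear_tensor_der])

lemma cobracket_pCons:
  "\<delta> (pCons a p) = novikov_cobracket_gen s \<Delta> a + tensor_der (poly_smult s) (\<delta> p)"
  unfolding novikov_cobracket_def
  by (rule subst_pCons[where f = "novikov_cobracket_gen s \<Delta>",
        OF additive_tensor_der additive.zero[OF additive_cobracket_gen]])

lemma cobracket_zero: "\<delta> 0 = 0"
  by (simp add: novikov_cobracket_def subst_zero additive.zero[OF additive_cobracket_gen])

lemma cobracket_der: "\<delta> (pCons 0 p) = tensor_der (poly_smult s) (\<delta> p)"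
  by (simp add: cobracket_pCons additive.zero[OF additive_cobracket_gen])

lemma additive_cobracket: "Modules.additive \<delta>"
  unfolding novikov_cobracket_def
  by (rule additive_subst[OF additive_tensor_der additive_cobracket_gen])

lemma cobracket_scale: "\<delta> (map_poly (s c) p) = fscale c (\<delta> p)"
proof (induction p)
  case 0
  show ?case by (simp add: cobracket_zero fscale_def fun_eq_iff)
next
  case (pCons a p)
  interpret V: Vector_Spaces.linear fscale fscale "tensor_der (poly_smult s)" by (rule linear_tensor_der)
  show ?case
    by (simp add: map_poly_pCons cobracket_pCons pCons.IH cobracket_gen_scale V.scale)
       (simp add: fscale_def fun_eq_iff algebra_simps)
qed

lemma linear_to_tensor_cobracket: "linear_to_tensor S \<delta>"
proof -
  have "\<delta> p \<in> tensor_space S S" for p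
  proof (induction p)
    case 0
    show ?case
      unfolding cobracket_zero by (rule tensor_space_closed(4)[OF cobracket_gen_in_tensor_space
          cobracket_gen_in_tensor_space])
  next
    case (pCons a p)
    show ?case
      unfolding cobracket_pCons
      by (intro tensor_space_closed cobracket_gen_in_tensor_space tensor_der_in_tensor_space pCons.IH)
  qed
  thus ?thesis
    by (simp add: linear_to_tensor_def linear_iff_additive vsR vector_space_fscale
        additive_cobracket cobracket_scale)
qed

lemmas cobracketD = linear_to_tensorD[OF linear_to_tensor_cobracket]

lemma cobracket_const: "bilinearR \<beta> \<Longrightarrow> \<delta> [:a:] \<beta> = E a (\<lambda>u v. \<beta> [:0, u:] [:v:] - \<beta> [:v:] [:0, u:])"
  by (simp add: novikov_cobracket_const cobracket_gen_eq)

lemma cobracket_der_eq: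
  "bilinearR \<beta> \<Longrightarrow> \<delta> (pCons 0 p) \<beta> = \<delta> p (\<lambda>x y. \<beta> (pCons 0 x) y) + \<delta> p (\<lambda>x y. \<beta> x (pCons 0 y))"
  by (simp add: cobracket_der tensor_der_eq)

lemma cobracket_der_const:
  assumes "bilinearR \<beta>"
  shows "\<delta> [:0, a:] \<beta> = E a (\<lambda>u v. \<beta> [:0, 0, u:] [:v:] - \<beta> [:0, v:] [:0, u:]
      + \<beta> [:0, u:] [:0, v:] - \<beta> [:v:] [:0, 0, u:])"
proof -
  have "bilinearR (\<lambda>x y. \<beta> (pCons 0 x) y)" "bilinearR (\<lambda>x y. \<beta> x (pCons 0 y))"
    by (intro bilinear_form_pullback[OF assms] linear_intros)+
  thus ?thesis
    by (simp add: cobracket_der_eq[OF assms, of "[:a:]", simplified] cobracket_const E_linear)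
qed

section \<open>The co-Jacobi identity\<close>

lemma id_tensor_comult:
  assumes "trilinearA \<gamma>"
  shows "id_tensor s \<Delta> (\<Delta> a) \<gamma> = E a (\<lambda>x y. E y (\<gamma> x))"
  using assms bilinear_comultiplied[OF comult assms] trilinear_form_fix[OF assms]
  by (simp add: id_tensor_def comult_eq)

lemma tensor_id_comult:
  assumes "trilinearA \<gamma>"
  shows "tensor_id s \<Delta> (\<Delta> a) \<gamma> = E a (\<lambda>x y. E x (\<lambda>u v. \<gamma> u v y))"
  using assms bilinear_comultiplied[OF comult assms] trilinear_form_fix[OF assms]
  by (simp add: tensor_id_def comult_eq)

lemma id_tensor_flip_comult:
  assumes "trilinearA \<gamma>"
  shows "id_tensor s \<Delta> (flip2 s (\<Delta> a)) \<gamma> = E a (\<lambda>x y. E x (\<gamma> y))"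
  using assms bilinear_comultiplied[OF comult assms] trilinear_form_fix[OF assms]
    bilinear_form_flip[OF bilinear_comultiplied(1)[OF comult assms]]
  by (simp add: id_tensor_def flip2_def comult_eq)

text \<open>The two Novikov coalgebra axioms at \<open>a\<close>, evaluated at a trilinear form.\<close>

definition coassoc_skew :: "'a \<Rightarrow> ('a \<Rightarrow> 'a \<Rightarrow> 'a \<Rightarrow> 'k) \<Rightarrow> bool" where
  "coassoc_skew a \<gamma> \<longleftrightarrow>
     E a (\<lambda>x y. E y (\<lambda>p q. \<gamma> x p q)) - E a (\<lambda>x y. E y (\<lambda>p q. \<gamma> p x q)) =
     E a (\<lambda>x y. E x (\<lambda>p q. \<gamma> p q y)) - E a (\<lambda>x y. E x (\<lambda>p q. \<gamma> q p y))"

definition coassoc_comm :: "'a \<Rightarrow> ('a \<Rightarrow> 'a \<Rightarrow> 'a \<Rightarrow> 'k) \<Rightarrow> bool" where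
  "coassoc_comm a \<gamma> \<longleftrightarrow>
     E a (\<lambda>x y. E x (\<lambda>p q. \<gamma> p y q)) = E a (\<lambda>x y. E x (\<lambda>p q. \<gamma> p q y))"

lemma novikov_coalgebra_iff:
  "novikov_coalgebra s \<Delta> \<longleftrightarrow> (\<forall>a \<gamma>. trilinearA \<gamma> \<longrightarrow> coassoc_skew a \<gamma> \<and> coassoc_comm a \<gamma>)"
proof -
  have 1: "id_tensor s \<Delta> (\<Delta> a) - flip_id s (id_tensor s \<Delta> (\<Delta> a)) =
      tensor_id s \<Delta> (\<Delta> a) - flip_id s (tensor_id s \<Delta> (\<Delta> a)) \<longleftrightarrow>
      (\<forall>\<gamma>. trilinearA \<gamma> \<longrightarrow> coassoc_skew a \<gamma>)" for a
  proof -
    have "(id_tensor s \<Delta> (\<Delta> a) - flip_id s (id_tensor s \<Delta> (\<Delta> a))) \<gamma> =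
      (tensor_id s \<Delta> (\<Delta> a) - flip_id s (tensor_id s \<Delta> (\<Delta> a))) \<gamma> \<longleftrightarrow>
      (trilinearA \<gamma> \<longrightarrow> coassoc_skew a \<gamma>)" for \<gamma>
    proof (cases "trilinearA \<gamma>")
      case True
      show ?thesis
        using True trilinear_form_perm(1)[OF True]
        by (simp add: flip_id_def id_tensor_comult tensor_id_comult coassoc_skew_def)
    qed (simp add: flip_id_def id_tensor_def tensor_id_def)
    thus ?thesis by (simp only: fun_eq_iff)
  qed
  have 2: "flip_id s (id_tensor s \<Delta> (flip2 s (\<Delta> a))) = tensor_id s \<Delta> (\<Delta> a) \<longleftrightarrow>
      (\<forall>\<gamma>. trilinearA \<gamma> \<longrightarrow> coassoc_comm a \<gamma>)" for a
  proof -
    have "flip_id s (id_tensor s \<Delta> (flip2 s (\<Delta> a))) \<gamma> = tensor_id s \<Delta> (\<Delta> a) \<gamma> \<longleftrightarrow>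
      (trilinearA \<gamma> \<longrightarrow> coassoc_comm a \<gamma>)" for \<gamma>
    proof (cases "trilinearA \<gamma>")
      case True
      show ?thesis
        using True trilinear_form_perm(1)[OF True]
        by (simp add: flip_id_def id_tensor_flip_comult tensor_id_comult coassoc_comm_def)
    qed (simp add: flip_id_def id_tensor_def tensor_id_def)
    thus ?thesis by (simp only: fun_eq_iff)
  qed
  have "\<exists>Basis. finite_dimensional_vector_space s Basis"
    using novikov by (simp add: novikov_algebra_def)
  thus ?thesis
    unfolding novikov_coalgebra_def 1 2 using comult by blast
qed

text \<open>The defect of the co-Jacobi identity at \<open>p\<close>, evaluated at a trilinear form.\<close>

definition cojac :: "'a poly \<Rightarrow> ('a poly \<Rightarrow> 'a poly \<Rightarrow> 'a poly \<Rightarrow> 'k) \<Rightarrow> 'k" where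
  "cojac p \<beta> = \<delta> p (\<lambda>x y. \<delta> y (\<beta> x)) - \<delta> p (\<lambda>x y. \<delta> y (\<lambda>u. \<beta> u x))
     - \<delta> p (\<lambda>x y. \<delta> x (\<lambda>u v. \<beta> u v y))"

lemma bilinearR_comultiplied:
  assumes "trilinearR \<beta>"
  shows "bilinearR (\<lambda>x y. \<delta> y (\<beta> x))" "bilinearR (\<lambda>x y. \<delta> x (\<lambda>u v. \<beta> u v y))"
  using bilinear_comultiplied[OF linear_to_tensor_cobracket assms] .

lemma trilinearR_der:
  assumes "trilinearR \<beta>"
  shows "trilinearR (\<lambda>x y z. \<beta> (pCons 0 x) y z)" "trilinearR (\<lambda>x y z. \<beta> x (pCons 0 y) z)"
    "trilinearR (\<lambda>x y z. \<beta> x y (pCons 0 z))"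
  by (intro trilinear_form_pullback[OF assms] linear_intros)+

lemma cobracket_right_der:
  assumes \<beta>: "trilinearR \<beta>"
  shows "\<delta> (pCons 0 p) (\<lambda>x y. \<delta> y (\<beta> x)) =
    \<delta> p (\<lambda>x y. \<delta> y (\<lambda>u v. \<beta> (pCons 0 x) u v)) + \<delta> p (\<lambda>x y. \<delta> y (\<lambda>u v. \<beta> x (pCons 0 u) v)) +
    \<delta> p (\<lambda>x y. \<delta> y (\<lambda>u v. \<beta> x u (pCons 0 v)))"
  using tensor_space_add[OF cobracketD(1) bilinearR_comultiplied(1)[OF trilinearR_der(2)[OF \<beta>]]
      bilinearR_comultiplied(1)[OF trilinearR_der(3)[OF \<beta>]], of p]
  by (simp add: cobracket_der_eq[OF bilinearR_comultiplied(1)[OF \<beta>]]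
      cobracket_der_eq[OF trilinear_form_fix(1)[OF \<beta>]])

lemma cobracket_left_der:
  assumes \<beta>: "trilinearR \<beta>"
  shows "\<delta> (pCons 0 p) (\<lambda>x y. \<delta> x (\<lambda>u v. \<beta> u v y)) =
    \<delta> p (\<lambda>x y. \<delta> x (\<lambda>u v. \<beta> (pCons 0 u) v y)) + \<delta> p (\<lambda>x y. \<delta> x (\<lambda>u v. \<beta> u (pCons 0 v) y)) +
    \<delta> p (\<lambda>x y. \<delta> x (\<lambda>u v. \<beta> u v (pCons 0 y)))"
  using tensor_space_add[OF cobracketD(1) bilinearR_comultiplied(2)[OF trilinearR_der(1)[OF \<beta>]]
      bilinearR_comultiplied(2)[OF trilinearR_der(2)[OF \<beta>]], of p]
  by (simp add: cobracket_der_eq[OF bilinearR_comultiplied(2)[OF \<beta>]]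
      cobracket_der_eq[OF trilinear_form_fix(2)[OF \<beta>]])

text \<open>
  Since \<open>\<delta>\<close> commutes with \<open>\<partial>\<close>, so does the defect, where \<open>\<partial>\<close> acts on \<open>R \<otimes> R \<otimes> R\<close> as a derivation; on forms
  this is precomposition with \<open>\<partial>\<close> in each argument.
\<close>

lemma cojac_der:
  assumes \<beta>: "trilinearR \<beta>"
  shows "cojac (pCons 0 p) \<beta> = cojac p (\<lambda>x y z. \<beta> (pCons 0 x) y z) +
    cojac p (\<lambda>x y z. \<beta> x (pCons 0 y) z) + cojac p (\<lambda>x y z. \<beta> x y (pCons 0 z))"
  using cobracket_right_der[OF trilinear_form_perm(1)[OF \<beta>], of p]
  by (simp add: cojac_def cobracket_right_der[OF \<beta>] cobracket_left_der[OF \<beta>])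

lemma cojac_if_constants:
  assumes "\<And>a \<beta>. trilinearR \<beta> \<Longrightarrow> cojac [:a:] \<beta> = 0" "trilinearR \<beta>"
  shows "cojac p \<beta> = 0"
  using assms(2)
proof (induction p arbitrary: \<beta>)
  case 0
  show ?case by (simp add: cojac_def cobracket_zero)
next
  case (pCons a p)
  have "cojac (pCons a p) \<beta> = cojac ([:a:] + pCons 0 p) \<beta>" by simp
  also have "\<dots> = cojac [:a:] \<beta> + cojac (pCons 0 p) \<beta>"
    by (simp only: cojac_def cobracketD(2)) (simp add: algebra_simps)
  also have "\<dots> = 0"
    by (simp add: cojac_der[OF pCons.prems] pCons.IH trilinearR_der[OF pCons.prems] assms(1)[OF pCons.prems])
  finally show ?case .
qed

lemma cobracket_flip:
  assumes "bilinearR \<beta>"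
  shows "\<delta> p (\<lambda>x y. \<beta> y x) = - \<delta> p \<beta>"
  using assms
proof (induction p arbitrary: \<beta>)
  case 0
  show ?case by (simp add: cobracket_zero)
next
  case (pCons a p)
  note flip = bilinear_form_flip[OF pCons.prems]
  have der: "bilinearR (\<lambda>x y. \<beta> (pCons 0 x) y)" "bilinearR (\<lambda>x y. \<beta> x (pCons 0 y))"
    by (intro bilinear_form_pullback[OF pCons.prems] linear_intros)+
  have "\<delta> (pCons 0 p) (\<lambda>x y. \<beta> y x) = - \<delta> (pCons 0 p) \<beta>"
    using pCons.IH[OF der(1)] pCons.IH[OF der(2)]
    by (simp add: cobracket_der_eq pCons.prems flip)
  moreover have "\<delta> [:a:] (\<lambda>x y. \<beta> y x) = - \<delta> [:a:] \<beta>"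
    by (simp add: cobracket_const pCons.prems flip E_linear)
  ultimately have "\<delta> ([:a:] + pCons 0 p) (\<lambda>x y. \<beta> y x) = - \<delta> ([:a:] + pCons 0 p) \<beta>"
    by (simp only: cobracketD(2)) simp
  thus ?case by simp
qed

lemma module_hom_cobracket: "module_hom (poly_smult s) (tensor_smult (poly_smult s)) \<delta>"
proof -
  have eq: "tensor_smult (poly_smult s) = operator_action fscale (tensor_der (poly_smult s))"
    by (intro ext) (simp add: tensor_smult_def operator_action_def)
  have "\<delta> (poly_smult s q p) = operator_action fscale (tensor_der (poly_smult s)) q (\<delta> p)" for q p
  proof (induction q)
    case 0
    have "poly_smult s 0 p = 0"
      by (simp add: poly_smult_eq_operator_action[OF vs] operator_action_zero linear_der)
    thus ?case by (simp add: operator_action_zero[OF linear_tensor_der] cobracket_zero)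
  next
    case (pCons c q)
    show ?case
      by (simp only: poly_smult_pCons[OF vs] operator_action_pCons[OF linear_tensor_der]
          additive.add[OF additive_cobracket] cobracket_scale cobracket_der pCons.IH)
  qed
  thus ?thesis
    unfolding eq module_hom_iff
    using module_poly_smult[OF vs] module_operator_action[OF linear_tensor_der]
      additive.add[OF additive_cobracket] by blast
qed

lemma lie_conformal_coalgebra_iff:
  "lie_conformal_coalgebra (poly_smult s) \<delta> \<longleftrightarrow> (\<forall>a \<beta>. trilinearR \<beta> \<longrightarrow> cojac [:a:] \<beta> = 0)"
proof -
  obtain B where B: "finite_dimensional_vector_space s B"
    using novikov by (auto simp: novikov_algebra_def)
  have skew: "\<delta> p = - flip2 S (\<delta> p)" for p
  proof
    fix \<beta>
    have "\<delta> p \<beta> = 0" if "\<not> bilinearR \<beta>"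
      using tensor_space_sweedler[OF cobracketD(1), of p] that by auto
    thus "\<delta> p \<beta> = (- flip2 S (\<delta> p)) \<beta>"
      by (auto simp: flip2_def cobracket_flip)
  qed
  have "id_tensor S \<delta> (\<delta> p) - flip_id S (id_tensor S \<delta> (\<delta> p)) = tensor_id S \<delta> (\<delta> p) \<longleftrightarrow>
      (\<forall>\<beta>. trilinearR \<beta> \<longrightarrow> cojac p \<beta> = 0)" for p
  proof -
    have "(id_tensor S \<delta> (\<delta> p) - flip_id S (id_tensor S \<delta> (\<delta> p))) \<beta> = tensor_id S \<delta> (\<delta> p) \<beta> \<longleftrightarrow>
      (trilinearR \<beta> \<longrightarrow> cojac p \<beta> = 0)" for \<beta>
      using trilinear_form_perm(1)[of S \<beta>]
      by (auto simp: id_tensor_def tensor_id_def flip_id_def cojac_def)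
    thus ?thesis by (simp only: fun_eq_iff)
  qed
  thus ?thesis
    unfolding lie_conformal_coalgebra_def kscale_poly_smult[OF vs]
    using fg_module_poly_smult[OF B] module_hom_cobracket cobracketD(1) skew cojac_if_constants
    by blast
qed

text \<open>
  The arguments \<open>[:u:]\<close>, \<open>[:0, u:]\<close> and \<open>[:0, 0, u:]\<close> are \<open>u\<close>, \<open>\<partial>u\<close> and \<open>\<partial>\<^sup>2u\<close>, so each summand belongs to the
  coefficient of one monomial of degree \<open>2\<close> in \<open>x, y, z\<close>.
\<close>

lemma cojac_const:
  assumes \<beta>: "trilinearR \<beta>"
  shows "cojac [:a:] \<beta> =
    E a (\<lambda>u v. E v (\<lambda>p q. \<beta> [:0, u:] [:0, p:] [:q:] - \<beta> [:0, u:] [:q:] [:0, p:])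
      - E u (\<lambda>p q. \<beta> [:v:] [:0, 0, p:] [:q:] - \<beta> [:v:] [:0, q:] [:0, p:]
          + \<beta> [:v:] [:0, p:] [:0, q:] - \<beta> [:v:] [:q:] [:0, 0, p:]))
    - E a (\<lambda>u v. E v (\<lambda>p q. \<beta> [:0, p:] [:0, u:] [:q:] - \<beta> [:q:] [:0, u:] [:0, p:])
      - E u (\<lambda>p q. \<beta> [:0, 0, p:] [:v:] [:q:] - \<beta> [:0, q:] [:v:] [:0, p:]
          + \<beta> [:0, p:] [:v:] [:0, q:] - \<beta> [:q:] [:v:] [:0, 0, p:]))
    - E a (\<lambda>u v. E u (\<lambda>p q. \<beta> [:0, 0, p:] [:q:] [:v:] - \<beta> [:0, q:] [:0, p:] [:v:]
          + \<beta> [:0, p:] [:0, q:] [:v:] - \<beta> [:q:] [:0, 0, p:] [:v:])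
      - E v (\<lambda>p q. \<beta> [:0, p:] [:q:] [:0, u:] - \<beta> [:q:] [:0, p:] [:0, u:]))"
proof -
  note \<beta>' = trilinear_form_perm(1)[OF \<beta>]
  note tf = trilinear_form_fix[OF \<beta>]
  show ?thesis
    unfolding cojac_def
    by (simp only: cobracket_const[OF bilinearR_comultiplied(1)[OF \<beta>]]
      cobracket_const[OF bilinearR_comultiplied(1)[OF \<beta>']] cobracket_const[OF bilinearR_comultiplied(2)[OF \<beta>]]
      cobracket_const[OF tf(1)] cobracket_const[OF tf(2)] cobracket_const[OF tf(3)]
      cobracket_der_const[OF tf(1)] cobracket_der_const[OF tf(2)] cobracket_der_const[OF tf(3)])
qed

text \<open>
  Coefficients of the co-Jacobi defect: \<open>xy\<close> and \<open>x\<^sup>2\<close> are the two coalgebra axioms; the other four are the same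
  two axioms with the tensor factors permuted.
\<close>

lemma coalgebra_equivalence:
  "lie_conformal_coalgebra (poly_smult s) \<delta> \<longleftrightarrow> novikov_coalgebra s \<Delta>"
  unfolding lie_conformal_coalgebra_iff novikov_coalgebra_iff
proof (intro iffI allI impI conjI)
  fix a \<gamma>
  assume *: "\<forall>a \<beta>. trilinearR \<beta> \<longrightarrow> cojac [:a:] \<beta> = 0" and \<gamma>: "trilinearA \<gamma>"
  have test: "trilinearR (\<lambda>x y z. \<gamma> (coeff x i) (coeff y j) (coeff z k))" for i j k
    by (intro trilinear_form_pullback[OF \<gamma>] linear_coeff)
  have 0 [simp]: "\<gamma> 0 x y = 0" "\<gamma> x 0 y = 0" "\<gamma> x y 0 = 0" for x y
  proof -
    have "\<gamma> (s 0 0) x y = 0 * \<gamma> 0 x y" "\<gamma> x (s 0 0) y = 0 * \<gamma> x 0 y" "\<gamma> x y (s 0 0) = 0 * \<gamma> x y 0"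
      using \<gamma> unfolding trilinear_form_iff by blast+
    thus "\<gamma> 0 x y = 0" "\<gamma> x 0 y = 0" "\<gamma> x y 0 = 0" by simp_all
  qed
  \<comment> \<open>the coefficient of \<open>xy\<close>\<close>
  show "coassoc_skew a \<gamma>"
    using cojac_const[OF test[of 1 1 0], of a] *[rule_format, OF test[of 1 1 0], of a]
    by (simp add: coassoc_skew_def E_linear coeff_pCons)
  \<comment> \<open>the coefficient of \<open>x\<^sup>2\<close>\<close>
  show "coassoc_comm a \<gamma>"
    using cojac_const[OF test[of 2 0 0], of a] *[rule_format, OF test[of 2 0 0], of a]
    by (simp add: coassoc_comm_def E_linear coeff_pCons)
next
  fix a \<beta>
  assume *: "\<forall>a \<gamma>. trilinearA \<gamma> \<longrightarrow> coassoc_skew a \<gamma> \<and> coassoc_comm a \<gamma>" and \<beta>: "trilinearR \<beta>"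
  \<comment> \<open>\<open>xy, xz, yz\<close> for the first axiom and \<open>x\<^sup>2, y\<^sup>2, z\<^sup>2\<close> for the second, with the permutation of
    the tensor factors under which the axiom gives that coefficient\<close>
  have tri: "trilinearA (\<lambda>x y z. \<beta> [:0, x:] [:0, y:] [:z:])"
    "trilinearA (\<lambda>x y z. \<beta> [:0, x:] [:z:] [:0, y:])"
    "trilinearA (\<lambda>x y z. \<beta> [:z:] [:0, x:] [:0, y:])"
    "trilinearA (\<lambda>x y z. \<beta> [:0, 0, x:] [:y:] [:z:])"
    "trilinearA (\<lambda>x y z. \<beta> [:y:] [:0, 0, x:] [:z:])"
    "trilinearA (\<lambda>x y z. \<beta> [:z:] [:y:] [:0, 0, x:])"
    by (intro trilinear_form_pullback[OF \<beta>] trilinear_form_pullback[OF trilinear_form_perm(1)[OF \<beta>]]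
        trilinear_form_pullback[OF trilinear_form_perm(2)[OF \<beta>]]
        trilinear_form_pullback[OF trilinear_form_perm(3)[OF \<beta>]]
        trilinear_form_pullback[OF trilinear_form_perm(4)[OF \<beta>]]
        trilinear_form_pullback[OF trilinear_form_perm(5)[OF \<beta>]] linear_intros)+
  note skew = *[rule_format, THEN conjunct1, unfolded coassoc_skew_def diff_eq_eq]
    and comm = *[rule_format, THEN conjunct2, unfolded coassoc_comm_def]
  show "cojac [:a:] \<beta> = 0"
    unfolding cojac_const[OF \<beta>]
    by (simp add: E_linear skew[OF tri(1)] skew[OF tri(2)] skew[OF tri(3)]
        comm[OF tri(4)] comm[OF tri(5)] comm[OF tri(6)])
qed

section \<open>The cocycle condition\<close>

abbreviation "act \<equiv> tensor_act (poly_smult s) br"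
abbreviation "T \<equiv> tensor_space S S"
abbreviation "d \<equiv> tensor_der (poly_smult s)"

lemma bilinear_map_bracket:
  "bilinear_map (kscale (poly_smult s)) (kscale (poly_smult s)) (\<lambda>c. map_poly (kscale (poly_smult s) c)) br"
  using lie_conformal_algebra_bracket by (simp add: lie_conformal_algebra_def)

lemma linear_bracket_coeff: "Vector_Spaces.linear S S (\<lambda>x. coeff (br p x) n)"
  by (simp add: Vector_Spaces.linear_iff vsR additive.add[OF br_sesqui(2)] bracket_scale coeff_map_poly)

lemma coeff_act:
  assumes "t \<in> T"
  shows "coeff (act p t) n \<beta> = (if bilinearR \<beta> then
    t (\<lambda>x y. \<beta> (coeff (br p x) n) y) + t (\<lambda>x y. \<beta> x (coeff (br p y) n)) else 0)"
  using coeff_tensor_act[OF bilinear_map_bracket, of t p n] assms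
  by (simp add: kscale_poly_smult[OF vs] tensor_map_def)

lemma bilinearR_act:
  assumes "bilinearR \<beta>"
  shows "bilinearR (\<lambda>x y. \<beta> (coeff (br p x) n) y)" "bilinearR (\<lambda>x y. \<beta> x (coeff (br p y) n))"
  by (intro bilinear_form_pullback[OF assms] linear_intros linear_bracket_coeff)+

lemma bilinearR_der:
  assumes "bilinearR \<beta>"
  shows "bilinearR (\<lambda>x y. \<beta> (pCons 0 x) y)" "bilinearR (\<lambda>x y. \<beta> x (pCons 0 y))"
  by (intro bilinear_form_pullback[OF assms] linear_intros)+

lemma poly_tens2_eqI:
  fixes P Q :: "('b, 'c, 'k) tens2 poly"
  assumes "\<And>n \<beta>. coeff P n \<beta> = coeff Q n \<beta>"
  shows "P = Q"
  using assms by (intro poly_eqI ext)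

lemma act_add_left:
  assumes t: "t \<in> T"
  shows "act (p + q) t = act p t + act q t"
proof (rule poly_tens2_eqI)
  fix n \<beta>
  show "coeff (act (p + q) t) n \<beta> = coeff (act p t + act q t) n \<beta>"
  proof (cases "bilinearR \<beta>")
    case True
    note b = bilinearR_act[OF True]
    show ?thesis
      using True
      by (simp add: coeff_act[OF t] additive.add[OF br_sesqui(1)] bilinear_form_linear[OF True]
          tensor_space_add[OF t b(1) b(1)] tensor_space_add[OF t b(2) b(2)])
  qed (simp add: coeff_act[OF t])
qed

lemma act_add_right: "t \<in> T \<Longrightarrow> u \<in> T \<Longrightarrow> act p (t + u) = act p t + act p u"
  by (rule poly_tens2_eqI) (simp add: coeff_act tensor_space_closed)

text \<open>
  The action of \<open>R\<close> on \<open>R \<otimes> R\<close> inherits sesquilinearity from the bracket, which makes the cocycle defect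
  sesquilinear as well.
\<close>

lemma act_der_left:
  assumes t: "t \<in> T"
  shows "act (pCons 0 p) t = - pCons 0 (act p t)"
proof (rule poly_tens2_eqI)
  fix n \<beta>
  show "coeff (act (pCons 0 p) t) n \<beta> = coeff (- pCons 0 (act p t)) n \<beta>"
  proof (cases "bilinearR \<beta>")
    case True
    note b = bilinearR_act[OF True]
    have zero: "t (\<lambda>x y. 0) = 0"
      using tensor_space_mult[OF t True, of 0] by simp
    show ?thesis
      using True zero
      by (cases n) (simp_all add: coeff_act[OF t] br_sesqui(3) bilinear_form_linear[OF True]
          tensor_space_uminus[OF t b(1)] tensor_space_uminus[OF t b(2)])
  next
    case False
    thus ?thesis by (cases n) (simp_all add: coeff_act[OF t])
  qed
qed

lemma coeff_map_der: "coeff (map_poly d w) n \<beta> = d (coeff w n) \<beta>"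
  by (simp add: coeff_map_poly additive.zero[OF additive_tensor_der])

lemma act_der_right:
  assumes t: "t \<in> T"
  shows "act p (d t) = pCons 0 (act p t) + map_poly d (act p t)"
proof (rule poly_tens2_eqI)
  fix n \<beta>
  note dt = tensor_der_in_tensor_space[OF t]
  show "coeff (act p (d t)) n \<beta> = coeff (pCons 0 (act p t) + map_poly d (act p t)) n \<beta>"
  proof (cases "bilinearR \<beta>")
    case True
    note b = bilinearR_act[OF True] and bd = bilinearR_der[OF True]
    have coeff_der: "coeff (br p (pCons 0 x)) n =
      (case n of 0 \<Rightarrow> 0 | Suc k \<Rightarrow> coeff (br p x) k) + pCons 0 (coeff (br p x) n)" for x
      by (simp add: br_sesqui(4) coeff_map_poly coeff_pCons)
    have 1: "t (\<lambda>x y. \<beta> (coeff (br p (pCons 0 x)) n) y) =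
        (case n of 0 \<Rightarrow> 0 | Suc k \<Rightarrow> t (\<lambda>x y. \<beta> (coeff (br p x) k) y)) + t (\<lambda>x y. \<beta> (pCons 0 (coeff (br p x) n)) y)"
      "t (\<lambda>x y. \<beta> x (coeff (br p (pCons 0 y)) n)) =
        (case n of 0 \<Rightarrow> 0 | Suc k \<Rightarrow> t (\<lambda>x y. \<beta> x (coeff (br p y) k))) + t (\<lambda>x y. \<beta> x (pCons 0 (coeff (br p y) n)))"
      unfolding coeff_der
      by (cases n; simp add: bilinear_form_linear[OF True]
          tensor_space_add[OF t b(1) bilinearR_act(1)[OF bd(1)]] tensor_space_add[OF t b(2) bilinearR_act(2)[OF bd(2)]])+
    have 2: "coeff (pCons 0 (act p t)) n \<beta> = (case n of 0 \<Rightarrow> 0 | Suc k \<Rightarrow> coeff (act p t) k \<beta>)"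
      by (simp add: coeff_pCons split: nat.splits)
    show ?thesis
      unfolding coeff_add plus_fun_apply coeff_map_der 2
      using True
      by (simp add: coeff_act[OF dt] coeff_act[OF t] tensor_der_eq b bd 1 split: nat.splits)
  next
    case False
    thus ?thesis
      by (cases n) (simp_all add: coeff_act[OF dt] coeff_act[OF t] coeff_map_der tensor_der_eq)
  qed
qed

definition cocycle :: "'a poly \<Rightarrow> 'a poly \<Rightarrow> ('a poly, 'a poly, 'k) tens2 poly" where
  "cocycle p q = act p (\<delta> q) - subst_minus d (act q (\<delta> p)) - map_poly \<delta> (br p q)"

lemma cocycle_if_constants:
  assumes "\<And>a b. cocycle [:a:] [:b:] = 0"
  shows "cocycle p q = 0"
proof -
  note sm = additive_subst_minus[OF additive_tensor_der]
  note md = additive_map_poly[OF additive_tensor_der]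
  note m\<delta> = additive_map_poly[OF additive_cobracket]
  note T = cobracketD(1)
  have [simp]: "map_poly \<delta> (pCons 0 w) = pCons 0 (map_poly \<delta> w)" for w
    by (simp add: map_poly_pCons cobracket_zero)
  have [simp]: "map_poly \<delta> (map_poly (pCons 0) w) = map_poly d (map_poly \<delta> w)" for w
    by (simp add: poly_eq_iff coeff_map_poly cobracket_zero additive.zero[OF additive_tensor_der] cobracket_der)
  note [simp] = additive.add[OF sm] additive.minus[OF sm] additive.add[OF md] additive.minus[OF md]
    additive.diff[OF md] additive.add[OF m\<delta>] additive.minus[OF m\<delta>]
    subst_minus_pCons[OF additive_tensor_der] subst_minus_map_poly[OF additive_tensor_der] br_sesqui(3,4)
    act_der_left[OF T] act_der_right[OF T] cobracket_der
  have add1: "Modules.additive (\<lambda>p. cocycle p q)" for q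
    by (simp add: additive_def cocycle_def act_add_left[OF T] act_add_right[OF T T]
        additive.add[OF additive_cobracket] additive.add[OF br_sesqui(1)] algebra_simps)
  have add2: "Modules.additive (cocycle p)" for p
    by (simp add: additive_def cocycle_def act_add_left[OF T] act_add_right[OF T T]
        additive.add[OF additive_cobracket] additive.add[OF br_sesqui(2)] algebra_simps)
  have 1: "cocycle (pCons 0 p) q = - pCons 0 (cocycle p q)" for p q
    by (simp add: cocycle_def)
  have 2: "cocycle p (pCons 0 q) = pCons 0 (cocycle p q) + map_poly d (cocycle p q)" for p q
    by (simp add: cocycle_def algebra_simps)
  have "cocycle [:a:] q = 0" for a
    by (rule additive_poly_eqI[OF add2]) (simp_all add: 2 assms)
  thus "cocycle p q = 0"
    by (rule additive_poly_eqI[OF add1]) (simp_all add: 1)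
qed

definition act_coeff :: "nat \<Rightarrow> 'a \<Rightarrow> 'a \<Rightarrow> ('a poly, 'a poly, 'k) tens2" where
  "act_coeff n a b = coeff (act [:a:] (\<delta> [:b:])) n"

lemma br_const_der: "br [:a:] [:0, u:] = [:[:0, 0, m u a:], [:0, m u a + star m a u:], [:star m a u:]:]"
  using br_sesqui(4)[of "[:a:]" "[:u:]"] by (simp add: novikov_bracket_const map_poly_pCons)

text \<open>
  The coefficients at \<open>\<lambda>\<^sup>0\<close>, \<open>\<lambda>\<^sup>1\<close> and \<open>\<lambda>\<^sup>2\<close> of \<open>a\<^sub>\<lambda> \<delta>(b)\<close>, evaluated at \<open>\<beta>\<close>; see \<open>act_coeff_eq\<close>.
\<close>

definition act_form0 :: "'a \<Rightarrow> 'a \<Rightarrow> ('a poly \<Rightarrow> 'a poly \<Rightarrow> 'k) \<Rightarrow> 'k" where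
  "act_form0 a b \<beta> = E b (\<lambda>u v. \<beta> [:0, 0, m u a:] [:v:] - \<beta> [:0, m v a:] [:0, u:]
      + \<beta> [:0, u:] [:0, m v a:] - \<beta> [:v:] [:0, 0, m u a:])"

definition act_form1 :: "'a \<Rightarrow> 'a \<Rightarrow> ('a poly \<Rightarrow> 'a poly \<Rightarrow> 'k) \<Rightarrow> 'k" where
  "act_form1 a b \<beta> = E b (\<lambda>u v. \<beta> [:0, m u a:] [:v:] + \<beta> [:0, star m a u:] [:v:] - \<beta> [:star m a v:] [:0, u:]
      + \<beta> [:0, u:] [:star m a v:] - \<beta> [:v:] [:0, m u a:] - \<beta> [:v:] [:0, star m a u:])"

definition act_form2 :: "'a \<Rightarrow> 'a \<Rightarrow> ('a poly \<Rightarrow> 'a poly \<Rightarrow> 'k) \<Rightarrow> 'k" where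
  "act_form2 a b \<beta> = E b (\<lambda>u v. \<beta> [:star m a u:] [:v:] - \<beta> [:v:] [:star m a u:])"

lemma act_coeff_eq:
  assumes \<beta>: "bilinearR \<beta>"
  shows "act_coeff 0 a b \<beta> = act_form0 a b \<beta>" "act_coeff 1 a b \<beta> = act_form1 a b \<beta>"
    "act_coeff 2 a b \<beta> = act_form2 a b \<beta>" "n \<ge> 3 \<Longrightarrow> act_coeff n a b \<beta> = 0"
proof -
  have split: "\<beta> [:0, x + y:] z = \<beta> [:0, x:] z + \<beta> [:0, y:] z" "\<beta> z [:0, x + y:] = \<beta> z [:0, x:] + \<beta> z [:0, y:]" for x y z
    using bilinear_form_linear(1)[OF \<beta>, of "[:0, x:]" "[:0, y:]"] bilinear_form_linear(2)[OF \<beta>, of _ "[:0, x:]" "[:0, y:]"]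
    by simp_all
  note [simp] = act_coeff_def coeff_act[OF cobracketD(1)] \<beta> bilinearR_act[OF \<beta>] cobracket_const
    br_const_der novikov_bracket_const bilinear_form_linear(5,6)[OF \<beta>] E_linear split
  show "act_coeff 0 a b \<beta> = act_form0 a b \<beta>" "act_coeff 1 a b \<beta> = act_form1 a b \<beta>"
    "act_coeff 2 a b \<beta> = act_form2 a b \<beta>"
    by (simp_all add: numeral_2_eq_2 act_form0_def act_form1_def act_form2_def)
  show "act_coeff n a b \<beta> = 0" if n: "n \<ge> 3"
  proof -
    obtain k where "n = Suc (Suc (Suc k))"
      using n by (metis Suc_le_D numeral_3_eq_3 Suc_le_mono)
    thus ?thesis by simp
  qed
qed

lemma act_coeff_in_T: "act_coeff n a b \<in> T"
  using coeff_tensor_act[OF bilinear_map_bracket, of "\<delta> [:b:]" "[:a:]" n] cobracketD(1)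
  by (simp add: act_coeff_def kscale_poly_smult[OF vs] id_def tensor_space_closed
      tensor_map_in_tensor_space[OF linear_bracket_coeff linear_id(2)]
      tensor_map_in_tensor_space[OF linear_id(2) linear_bracket_coeff])

lemma act_const: "act [:a:] (\<delta> [:b:]) = [:act_coeff 0 a b, act_coeff 1 a b, act_coeff 2 a b:]"
proof (rule poly_eqI)
  fix n
  show "coeff (act [:a:] (\<delta> [:b:])) n = coeff [:act_coeff 0 a b, act_coeff 1 a b, act_coeff 2 a b:] n"
  proof (cases "n \<ge> 3")
    case True
    have "act_coeff n a b = 0"
      by (rule tens2_eqI[OF act_coeff_in_T tensor_space_closed(4)[OF act_coeff_in_T act_coeff_in_T]])
         (simp add: act_coeff_eq(4)[OF _ True])
    thus ?thesis using True by (simp add: act_coeff_def coeff_eq_0)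
  next
    case False
    hence "n = 0 \<or> n = 1 \<or> n = 2" by auto
    thus ?thesis by (auto simp: act_coeff_def numeral_2_eq_2)
  qed
qed

text \<open>
  Substituting \<open>\<mu> = -\<lambda> - \<partial>\<close> into \<open>w\<^sub>0 + \<mu> w\<^sub>1 + \<mu>\<^sup>2 w\<^sub>2 = b\<^sub>\<mu> \<delta>(a)\<close> gives the coefficients \<open>w\<^sub>0 - \<partial>w\<^sub>1 + \<partial>\<^sup>2w\<^sub>2\<close>,
  \<open>2\<partial>w\<^sub>2 - w\<^sub>1\<close> and \<open>w\<^sub>2\<close> at \<open>\<lambda>\<^sup>0\<close>, \<open>\<lambda>\<^sup>1\<close> and \<open>\<lambda>\<^sup>2\<close>, while \<open>\<delta>([a\<^sub>\<lambda> b]) = \<delta>(\<partial>(b \<circ> a)) + \<lambda> \<delta>(a \<star> b)\<close>.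
\<close>

lemma cocycle_const:
  "cocycle [:a:] [:b:] = 0 \<longleftrightarrow>
     act_coeff 0 a b - act_coeff 0 b a + d (act_coeff 1 b a) - d (d (act_coeff 2 b a)) = \<delta> [:0, m b a:] \<and>
     act_coeff 1 a b + act_coeff 1 b a - d (act_coeff 2 b a) - d (act_coeff 2 b a) = \<delta> [:star m a b:] \<and>
     act_coeff 2 a b = act_coeff 2 b a"
proof -
  have [simp]: "d 0 = 0" "d (- x) = - d x" "d (x - y) = d x - d y" for x y
    using additive.zero[OF additive_tensor_der] additive.minus[OF additive_tensor_der]
      additive.diff[OF additive_tensor_der] by auto
  show ?thesis
    by (simp add: cocycle_def act_const subst_minus_pCons[OF additive_tensor_der] subst_minus_zero
        map_poly_pCons novikov_bracket_const cobracket_zero)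
       (auto simp: algebra_simps)
qed

section \<open>The compatibility conditions of a Novikov bialgebra\<close>

text \<open>
  The three compatibility conditions, evaluated at a bilinear form; a summand \<open>\<gamma> y \<dots>\<close> or \<open>\<gamma> (\<dots> y) \<dots>\<close>
  with \<open>y\<close> in first position comes from \<open>\<tau>\<Delta>\<close>.
\<close>

definition compat_comult :: "'a \<Rightarrow> 'a \<Rightarrow> ('a \<Rightarrow> 'a \<Rightarrow> 'k) \<Rightarrow> bool" where
  "compat_comult a b \<gamma> \<longleftrightarrow>
     E (m a b) \<gamma> = E a (\<lambda>x y. \<gamma> (m x b) y) +
       (E b (\<lambda>x y. \<gamma> x (star m a y)) + E b (\<lambda>x y. \<gamma> y (star m a x)))"

definition compat_star :: "'a \<Rightarrow> 'a \<Rightarrow> ('a \<Rightarrow> 'a \<Rightarrow> 'k) \<Rightarrow> bool" where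
  "compat_star a b \<gamma> \<longleftrightarrow>
     E b (\<lambda>x y. \<gamma> (star m a x) y) - E b (\<lambda>x y. \<gamma> y (star m a x)) =
     E a (\<lambda>x y. \<gamma> (star m b x) y) - E a (\<lambda>x y. \<gamma> y (star m b x))"

definition compat_right :: "'a \<Rightarrow> 'a \<Rightarrow> ('a \<Rightarrow> 'a \<Rightarrow> 'k) \<Rightarrow> bool" where
  "compat_right a b \<gamma> \<longleftrightarrow>
     E b (\<lambda>x y. \<gamma> x (m y a)) + E b (\<lambda>x y. \<gamma> y (m x a)) -
       (E b (\<lambda>x y. \<gamma> (m x a) y) + E b (\<lambda>x y. \<gamma> (m y a) x)) =
     E a (\<lambda>x y. \<gamma> x (m y b)) + E a (\<lambda>x y. \<gamma> y (m x b)) -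
       (E a (\<lambda>x y. \<gamma> (m x b) y) + E a (\<lambda>x y. \<gamma> (m y b) x))"

lemma novikov_bialgebra_iff:
  "novikov_bialgebra s m \<Delta> \<longleftrightarrow> novikov_coalgebra s \<Delta> \<and>
     (\<forall>a b \<gamma>. bilinearA \<gamma> \<longrightarrow> compat_comult a b \<gamma> \<and> compat_star a b \<gamma> \<and> compat_right a b \<gamma>)"
proof -
  have bil: "bilinearA (\<lambda>x y. \<gamma> (star m a x) y)" "bilinearA (\<lambda>x y. \<gamma> x (star m a y))"
    "bilinearA (\<lambda>x y. \<gamma> (m x a) y)" "bilinearA (\<lambda>x y. \<gamma> x (m y a))"
    "bilinearA (\<lambda>x y. \<gamma> y (star m a x))" "bilinearA (\<lambda>x y. \<gamma> (star m a y) x)"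
    "bilinearA (\<lambda>x y. \<gamma> y (m x a))" "bilinearA (\<lambda>x y. \<gamma> (m y a) x)"
    if "bilinearA \<gamma>" for \<gamma> a
    by (intro bilinear_form_pullback[OF that] bilinear_form_pullback[OF bilinear_form_flip[OF that]]
        linear_intros)+
  have 1: "\<Delta> (m a b) = tensor_map s s (\<lambda>x. m x b) id (\<Delta> a) +
      tensor_map s s id (star m a) (\<Delta> b + flip2 s (\<Delta> b)) \<longleftrightarrow>
    (\<forall>\<gamma>. bilinearA \<gamma> \<longrightarrow> compat_comult a b \<gamma>)" for a b
  proof -
    have "\<Delta> (m a b) \<gamma> = (tensor_map s s (\<lambda>x. m x b) id (\<Delta> a) +
      tensor_map s s id (star m a) (\<Delta> b + flip2 s (\<Delta> b))) \<gamma> \<longleftrightarrow> (bilinearA \<gamma> \<longrightarrow> compat_comult a b \<gamma>)" for \<gamma>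
      by (cases "bilinearA \<gamma>") (simp_all add: comult_eq tensor_map_def flip2_def bil compat_comult_def)
    thus ?thesis by (simp only: fun_eq_iff)
  qed
  have 2: "tensor_map s s (star m a) id (\<Delta> b) - tensor_map s s id (star m a) (flip2 s (\<Delta> b)) =
      tensor_map s s (star m b) id (\<Delta> a) - tensor_map s s id (star m b) (flip2 s (\<Delta> a)) \<longleftrightarrow>
    (\<forall>\<gamma>. bilinearA \<gamma> \<longrightarrow> compat_star a b \<gamma>)" for a b
  proof -
    have "(tensor_map s s (star m a) id (\<Delta> b) - tensor_map s s id (star m a) (flip2 s (\<Delta> b))) \<gamma> =
      (tensor_map s s (star m b) id (\<Delta> a) - tensor_map s s id (star m b) (flip2 s (\<Delta> a))) \<gamma> \<longleftrightarrow>
      (bilinearA \<gamma> \<longrightarrow> compat_star a b \<gamma>)" for \<gamma>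
      by (cases "bilinearA \<gamma>") (simp_all add: comult_eq tensor_map_def flip2_def bil compat_star_def)
    thus ?thesis by (simp only: fun_eq_iff)
  qed
  have 3: "tensor_map s s id (\<lambda>x. m x a) (\<Delta> b + flip2 s (\<Delta> b)) -
      tensor_map s s (\<lambda>x. m x a) id (\<Delta> b + flip2 s (\<Delta> b)) =
      tensor_map s s id (\<lambda>x. m x b) (\<Delta> a + flip2 s (\<Delta> a)) -
      tensor_map s s (\<lambda>x. m x b) id (\<Delta> a + flip2 s (\<Delta> a)) \<longleftrightarrow>
    (\<forall>\<gamma>. bilinearA \<gamma> \<longrightarrow> compat_right a b \<gamma>)" for a b
  proof -
    have "(tensor_map s s id (\<lambda>x. m x a) (\<Delta> b + flip2 s (\<Delta> b)) -
      tensor_map s s (\<lambda>x. m x a) id (\<Delta> b + flip2 s (\<Delta> b))) \<gamma> =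
      (tensor_map s s id (\<lambda>x. m x b) (\<Delta> a + flip2 s (\<Delta> a)) -
      tensor_map s s (\<lambda>x. m x b) id (\<Delta> a + flip2 s (\<Delta> a))) \<gamma> \<longleftrightarrow>
      (bilinearA \<gamma> \<longrightarrow> compat_right a b \<gamma>)" for \<gamma>
      by (cases "bilinearA \<gamma>") (simp_all add: comult_eq tensor_map_def flip2_def bil compat_right_def)
    thus ?thesis by (simp only: fun_eq_iff)
  qed
  show ?thesis
    unfolding novikov_bialgebra_def 1 2 3 using novikov by blast
qed

text \<open>
  The equations at \<open>\<lambda>\<^sup>0\<close> and \<open>\<lambda>\<^sup>1\<close> in \<open>cocycle_const\<close>, evaluated at \<open>\<beta>\<close>: \<open>\<partial>\<close> acts on \<open>R \<otimes> R\<close> as \<open>x + y\<close>, and on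
  forms by precomposition.
\<close>

definition cocycle_form0 :: "'a \<Rightarrow> 'a \<Rightarrow> ('a poly \<Rightarrow> 'a poly \<Rightarrow> 'k) \<Rightarrow> bool" where
  "cocycle_form0 a b \<beta> \<longleftrightarrow>
     act_form0 a b \<beta> - act_form0 b a \<beta>
     + (act_form1 b a (\<lambda>x y. \<beta> (pCons 0 x) y) + act_form1 b a (\<lambda>x y. \<beta> x (pCons 0 y)))
     - (act_form2 b a (\<lambda>x y. \<beta> (pCons 0 (pCons 0 x)) y) + act_form2 b a (\<lambda>x y. \<beta> (pCons 0 x) (pCons 0 y))
        + (act_form2 b a (\<lambda>x y. \<beta> (pCons 0 x) (pCons 0 y)) + act_form2 b a (\<lambda>x y. \<beta> x (pCons 0 (pCons 0 y)))))
     = E (m b a) (\<lambda>u v. \<beta> [:0, 0, u:] [:v:] - \<beta> [:0, v:] [:0, u:] + \<beta> [:0, u:] [:0, v:] - \<beta> [:v:] [:0, 0, u:])"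

definition cocycle_form1 :: "'a \<Rightarrow> 'a \<Rightarrow> ('a poly \<Rightarrow> 'a poly \<Rightarrow> 'k) \<Rightarrow> bool" where
  "cocycle_form1 a b \<beta> \<longleftrightarrow>
     act_form1 a b \<beta> + act_form1 b a \<beta>
     - (act_form2 b a (\<lambda>x y. \<beta> (pCons 0 x) y) + act_form2 b a (\<lambda>x y. \<beta> x (pCons 0 y)))
     - (act_form2 b a (\<lambda>x y. \<beta> (pCons 0 x) y) + act_form2 b a (\<lambda>x y. \<beta> x (pCons 0 y)))
     = E (star m a b) (\<lambda>u v. \<beta> [:0, u:] [:v:] - \<beta> [:v:] [:0, u:])"

lemma cocycle_const_iff:
  "cocycle [:a:] [:b:] = 0 \<longleftrightarrow>
     (\<forall>\<beta>. bilinearR \<beta> \<longrightarrow> cocycle_form0 a b \<beta> \<and> cocycle_form1 a b \<beta> \<and> act_form2 a b \<beta> = act_form2 b a \<beta>)"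
proof -
  note mem = act_coeff_in_T tensor_der_in_tensor_space[OF act_coeff_in_T]
    tensor_der_in_tensor_space[OF tensor_der_in_tensor_space[OF act_coeff_in_T]] cobracketD(1)
  have eq_iff: "t = u \<longleftrightarrow> (\<forall>\<beta>. bilinearR \<beta> \<longrightarrow> t \<beta> = u \<beta>)" if "t \<in> T" "u \<in> T" for t u
    using tens2_eqI[OF that] by blast
  have "act_coeff 0 a b - act_coeff 0 b a + d (act_coeff 1 b a) - d (d (act_coeff 2 b a)) = \<delta> [:0, m b a:]
      \<longleftrightarrow> (\<forall>\<beta>. bilinearR \<beta> \<longrightarrow> cocycle_form0 a b \<beta>)"
  proof -
    have "(act_coeff 0 a b - act_coeff 0 b a + d (act_coeff 1 b a) - d (d (act_coeff 2 b a))) \<beta> = \<delta> [:0, m b a:] \<beta>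
      \<longleftrightarrow> cocycle_form0 a b \<beta>" if \<beta>: "bilinearR \<beta>" for \<beta>
    proof -
      note \<beta>1 = bilinearR_der[OF \<beta>]
      note \<beta>2 = bilinearR_der[OF \<beta>1(1)] bilinearR_der[OF \<beta>1(2)]
      show ?thesis
        unfolding cocycle_form0_def cobracket_der_const[OF \<beta>]
        by (simp add: tensor_der_eq act_coeff_eq(1-3) \<beta> \<beta>1 \<beta>2 del: One_nat_def)
    qed
    thus ?thesis by (subst eq_iff) (intro tensor_space_closed mem | simp)+
  qed
  moreover have "act_coeff 1 a b + act_coeff 1 b a - d (act_coeff 2 b a) - d (act_coeff 2 b a) = \<delta> [:star m a b:]
      \<longleftrightarrow> (\<forall>\<beta>. bilinearR \<beta> \<longrightarrow> cocycle_form1 a b \<beta>)"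
  proof -
    have "(act_coeff 1 a b + act_coeff 1 b a - d (act_coeff 2 b a) - d (act_coeff 2 b a)) \<beta> = \<delta> [:star m a b:] \<beta>
      \<longleftrightarrow> cocycle_form1 a b \<beta>" if \<beta>: "bilinearR \<beta>" for \<beta>
    proof -
      note \<beta>1 = bilinearR_der[OF \<beta>]
      show ?thesis
        unfolding cocycle_form1_def cobracket_const[OF \<beta>]
        by (simp only: tensor_der_eq act_coeff_eq(1-3) \<beta> \<beta>1 plus_fun_apply minus_apply if_True)
    qed
    thus ?thesis by (subst eq_iff) (intro tensor_space_closed mem | simp)+
  qed
  moreover have "act_coeff 2 a b = act_coeff 2 b a \<longleftrightarrow>
      (\<forall>\<beta>. bilinearR \<beta> \<longrightarrow> act_form2 a b \<beta> = act_form2 b a \<beta>)"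
    using act_coeff_eq(3) by (subst eq_iff[OF mem(1) mem(1)]) simp
  ultimately show ?thesis unfolding cocycle_const by blast
qed

text \<open>
  At \<open>\<lambda>\<^sup>0\<close> the coefficient of \<open>x\<^sup>2\<close> determines \<open>\<Delta>(b \<circ> a)\<close>.  The coefficient of \<open>xy\<close> contains
  \<open>\<Delta>(b \<circ> a) - \<tau>\<Delta>(b \<circ> a)\<close>, and becomes the condition on right multiplications once this is replaced.
\<close>

lemma compat_if_cocycle:
  assumes cocycle: "\<And>a b. cocycle [:a:] [:b:] = 0" and \<gamma>: "bilinearA \<gamma>"
  shows "compat_comult a b \<gamma> \<and> compat_star a b \<gamma> \<and> compat_right a b \<gamma>"
proof -
  note forms = cocycle[unfolded cocycle_const_iff, rule_format]
  have test: "bilinearR (\<lambda>x y. \<gamma> (coeff x i) (coeff y j))" if "bilinearA \<gamma>" for \<gamma> i j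
    by (intro bilinear_form_pullback[OF that] linear_coeff)
  have comult: "compat_comult b a \<gamma>" if \<gamma>: "bilinearA \<gamma>" for a b \<gamma>
    using forms[OF test[OF \<gamma>, of 2 0], of a b, THEN conjunct1]
    by (simp add: cocycle_form0_def act_form0_def act_form1_def act_form2_def compat_comult_def
        bilinear_form_linear(5,6)[OF \<gamma>] E_linear coeff_pCons algebra_simps)
  have star: "compat_star a b \<gamma>"
    using forms[OF test[OF \<gamma>, of 0 0], of a b, THEN conjunct2, THEN conjunct2]
    by (simp add: act_form2_def compat_star_def E_linear)
  have "compat_right a b \<gamma>"
    using forms[OF test[OF \<gamma>, of 1 1], of a b, THEN conjunct1]
      comult[OF \<gamma>, of b a] comult[OF bilinear_form_flip[OF \<gamma>], of b a]
    by (simp add: cocycle_form0_def act_form0_def act_form1_def act_form2_def compat_comult_def compat_right_def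
        bilinear_form_linear(5,6)[OF \<gamma>] E_linear coeff_pCons algebra_simps)
  with comult star \<gamma> show ?thesis by blast
qed

text \<open>
  The coefficients of \<open>\<lambda>x\<close> and \<open>\<lambda>y\<close> involve \<open>\<Delta>(a \<star> b) = \<Delta>(a \<circ> b) + \<Delta>(b \<circ> a)\<close>; after the formula for \<open>\<Delta>\<close> of a product
  is inserted, what is left is the condition on \<open>L\<^sub>\<star>\<close>.
\<close>

lemma cocycle_if_compat:
  assumes compat: "\<And>a b \<gamma>. bilinearA \<gamma> \<Longrightarrow> compat_comult a b \<gamma> \<and> compat_star a b \<gamma> \<and> compat_right a b \<gamma>"
  shows "cocycle [:a:] [:b:] = 0"
  unfolding cocycle_const_iff
proof (intro allI impI conjI)
  fix \<beta> assume \<beta>: "bilinearR \<beta>"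
  note comult = compat[THEN conjunct1, unfolded compat_comult_def]
    and star = compat[THEN conjunct2, THEN conjunct1, unfolded compat_star_def diff_eq_eq]
    and right = compat[THEN conjunct2, THEN conjunct2, unfolded compat_right_def]
  \<comment> \<open>a linear equation between values of \<open>E\<close>, solved for one of them to serve as a rewrite rule\<close>
  have isolate: "A = R + C - B" if "A + B - C = R" for A B C R :: 'k
    using that by (simp add: algebra_simps)
  have bil: "bilinearA (\<lambda>u v. \<beta> [:u:] [:v:])"
    "bilinearA (\<lambda>u v. \<beta> [:0, u:] [:v:])" "bilinearA (\<lambda>u v. \<beta> [:v:] [:0, u:])"
    "bilinearA (\<lambda>u v. \<beta> [:0, u:] [:0, v:])" "bilinearA (\<lambda>u v. \<beta> [:0, v:] [:0, u:])"
    "bilinearA (\<lambda>u v. \<beta> [:0, 0, u:] [:v:])" "bilinearA (\<lambda>u v. \<beta> [:v:] [:0, 0, u:])"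
    by (intro bilinear_form_pullback[OF \<beta>] bilinear_form_pullback[OF bilinear_form_flip[OF \<beta>]] linear_intros)+
  show "act_form2 a b \<beta> = act_form2 b a \<beta>"
    using star[OF bil(1), of a b] by (simp add: act_form2_def E_linear)
  show "cocycle_form1 a b \<beta>"
    using comult[OF bil(2), of a b] comult[OF bil(2), of b a] comult[OF bil(3), of a b] comult[OF bil(3), of b a]
      star[OF bil(2), of a b] star[OF bil(3), of a b]
      E_linear_arg(1)[OF bil(2), of "m a b" "m b a"] E_linear_arg(1)[OF bil(3), of "m a b" "m b a"]
    by (simp add: cocycle_form1_def act_form1_def act_form2_def E_linear star_def[of m a b])
  show "cocycle_form0 a b \<beta>"
    using comult[OF bil(4), of b a] comult[OF bil(5), of b a]
      comult[OF bil(6), of b a] comult[OF bil(7), of b a] isolate[OF right[OF bil(4), of a b]]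
    by (simp add: cocycle_form0_def act_form0_def act_form1_def act_form2_def E_linear)
qed

theorem bialgebra_equivalence:
  "lie_conformal_bialgebra (poly_smult s) br \<delta> \<longleftrightarrow> novikov_bialgebra s m \<Delta>"
proof -
  have "(\<forall>p q. cocycle p q = 0) \<longleftrightarrow>
      (\<forall>a b \<gamma>. bilinearA \<gamma> \<longrightarrow> compat_comult a b \<gamma> \<and> compat_star a b \<gamma> \<and> compat_right a b \<gamma>)"
    using cocycle_if_constants cocycle_if_compat compat_if_cocycle by blast
  moreover have "act p (\<delta> q) - subst_minus d (act q (\<delta> p)) = map_poly \<delta> (br p q) \<longleftrightarrow> cocycle p q = 0" for p q
    by (simp add: cocycle_def)
  ultimately show ?thesis
    unfolding lie_conformal_bialgebra_def novikov_bialgebra_iff coalgebra_equivalence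
    using lie_conformal_algebra_bracket by simp
qed

end

theorem corollary2p14:
  fixes s :: "'k::field_char_0 \<Rightarrow> 'a::ab_group_add \<Rightarrow> 'a"
    and m :: "'a \<Rightarrow> 'a \<Rightarrow> 'a"
    and \<Delta> :: "'a \<Rightarrow> ('a, 'a, 'k) tens2"
  assumes "novikov_algebra s m"
    and "linear_to_tensor s \<Delta>"
  shows "lie_conformal_bialgebra (poly_smult s) (novikov_bracket m) (novikov_cobracket s \<Delta>)
    \<longleftrightarrow> novikov_bialgebra s m \<Delta>"
proof -
  interpret novikov_comult s m \<Delta>
    by unfold_locales (rule assms)+
  show ?thesis
    by (rule bialgebra_equivalence)
qed

end
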